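(* Let $q>0$ and let $f\in\mathrm{LC}(\mathbb{R}^n)$ have nonzero finite $L^1$ norm. If $K_f$, the support of $f$, contains the origin as an interior point, then $$\int_{\mathbb{R}^n}|x|\,d\widetilde{C}^{e}_{q}(f;x)=\int_{\mathbb{R}^n}|\nabla f(x)|\cdot|x|^{q-n}\,dx<\infty.$$ In particular, this is valid for every even $f\in\mathrm{LC}(\mathbb{R}^n)$ with nonzero finite $L^1$ norm.
   Context: $\mathrm{LC}(\mathbb{R}^n)$ is the set of all upper semi-continuous log-concave functions $f:\mathbb{R}^n\to[0,\infty)$, i.e. $f=e^{-\phi}$ with $\phi:\mathbb{R}^n\to(-\infty,\infty]$ lower semi-continuous and convex. Such an $f$ is differentiable almost everywhere, and $\nabla f$ denotes its almost everywhere defined gradient. For $f=e^{-\phi}\in\mathrm{LC}(\mathbb{R}^n)$ with nonzero finite $L^1$ norm, the Euclidean $q$-th dual curvature measure of $f$ is the Borel measure on $\mathbb{R}^n$ $$\widetilde{C}^{e}_{q}(f;\mathcal{B})=\int_{\{x:\,\nabla\phi(x)\in\mathcal{B}\}}|x|^{q-n}f(x)\,dx$$ for Borel $\mathcal{B}\subset\mathbb{R}^n$ (here $\nabla\phi$ exists almost everywhere on $\{\phi<\infty\}=\{f>0\}$). *)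

theory Defs
  imports "HOL-Analysis.Analysis"
begin

text \<open>Convex functions take values in \<open>(-\<infinity>, \<infinity>]\<close>; they are modelled as \<^typ>\<open>ereal\<close>-valued functions
  that avoid \<open>-\<infinity>\<close>. On coefficients in \<open>[0, 1]\<close>, \<^typ>\<open>ereal\<close> arithmetic uses \<open>0 * \<infinity> = 0\<close>.\<close>

definition convex_fun :: "(real^'n \<Rightarrow> ereal) \<Rightarrow> bool" where
  "convex_fun \<phi> \<longleftrightarrow>
     (\<forall>x. \<phi> x \<noteq> - \<infinity>) \<and>
     (\<forall>x y. \<forall>t\<in>{0..1::real}.
        \<phi> ((1 - t) *\<^sub>R x + t *\<^sub>R y) \<le> ereal (1 - t) * \<phi> x + ereal t * \<phi> y)"

definition lower_semicontinuous :: "(real^'n \<Rightarrow> ereal) \<Rightarrow> bool" where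
  "lower_semicontinuous \<phi> \<longleftrightarrow> (\<forall>x. \<forall>t<\<phi> x. \<forall>\<^sub>F y in nhds x. t < \<phi> y)"

text \<open>\<open>exp_neg a\<close> is \<open>e\<^sup>-\<^sup>a\<close> for \<open>a \<in> (-\<infinity>, \<infinity>]\<close>; the value at \<open>-\<infinity>\<close> is irrelevant.\<close>

definition exp_neg :: "ereal \<Rightarrow> real" where
  "exp_neg a = (if a = \<infinity> then 0 else exp (- real_of_ereal a))"

definition LC :: "(real^'n \<Rightarrow> real) set" where
  "LC = {f. \<exists>\<phi>. convex_fun \<phi> \<and> lower_semicontinuous \<phi> \<and> f = (\<lambda>x. exp_neg (\<phi> x))}"

text \<open>The function \<open>\<phi>\<close> with \<open>f = e\<^sup>-\<^sup>\<phi>\<close>, recovered from \<open>f\<close>.\<close>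

definition neg_log :: "(real^'n \<Rightarrow> real) \<Rightarrow> real^'n \<Rightarrow> ereal" where
  "neg_log f x = (if f x = 0 then \<infinity> else ereal (- ln (f x)))"

lemma neg_log_exp_neg:
  assumes "\<And>x. \<phi> x \<noteq> - \<infinity>"
  shows "neg_log (\<lambda>x. exp_neg (\<phi> x)) = \<phi>"
proof
  fix x
  show "neg_log (\<lambda>x. exp_neg (\<phi> x)) x = \<phi> x"
    using assms[of x] by (cases "\<phi> x") (auto simp: neg_log_def exp_neg_def)
qed

lemma LC_iff_neg_log:
  "f \<in> LC \<longleftrightarrow> (\<forall>x. 0 \<le> f x) \<and> convex_fun (neg_log f) \<and> lower_semicontinuous (neg_log f)"
proof
  assume "f \<in> LC"
  then obtain \<phi> where \<phi>: "convex_fun \<phi>" "lower_semicontinuous \<phi>" "f = (\<lambda>x. exp_neg (\<phi> x))"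
    by (auto simp: LC_def)
  moreover have "neg_log f = \<phi>"
    using \<phi> by (simp add: neg_log_exp_neg convex_fun_def)
  ultimately show "(\<forall>x. 0 \<le> f x) \<and> convex_fun (neg_log f) \<and> lower_semicontinuous (neg_log f)"
    by (simp add: exp_neg_def)
next
  assume *: "(\<forall>x. 0 \<le> f x) \<and> convex_fun (neg_log f) \<and> lower_semicontinuous (neg_log f)"
  have "f x = exp_neg (neg_log f x)" for x
    using * by (auto simp: exp_neg_def neg_log_def less_le)
  with * show "f \<in> LC"
    unfolding LC_def by blast
qed

text \<open>Differentiability of an extended-valued function at \<open>x\<close> presupposes that it is finite near
  \<open>x\<close>; without this, the convention \<open>real_of_ereal \<infinity> = 0\<close> could create spurious gradients.\<close>

definition has_ext_gradient :: "(real^'n \<Rightarrow> ereal) \<Rightarrow> real^'n \<Rightarrow> real^'n \<Rightarrow> bool" where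
  "has_ext_gradient \<phi> x v \<longleftrightarrow>
     x \<in> interior {y. \<bar>\<phi> y\<bar> \<noteq> \<infinity>} \<and> GDERIV (\<lambda>y. real_of_ereal (\<phi> y)) x :> v"

text \<open>The value \<open>0\<close> at points of non-differentiability is immaterial for \<open>f \<in> LC\<close>, where these
  points form a null set.\<close>

definition gradient :: "(real^'n \<Rightarrow> real) \<Rightarrow> real^'n \<Rightarrow> real^'n" where
  "gradient f x = (if \<exists>v. GDERIV f x :> v then THE v. GDERIV f x :> v else 0)"

definition supp :: "(real^'n \<Rightarrow> real) \<Rightarrow> (real^'n) set" where
  "supp f = closure {x. f x \<noteq> 0}"

definition dual_curvature_measure :: "real \<Rightarrow> (real^'n \<Rightarrow> real) \<Rightarrow> (real^'n) measure" where
  "dual_curvature_measure q f =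
     measure_of UNIV (sets borel)
       (\<lambda>B. \<integral>\<^sup>+x\<in>{x. \<exists>v\<in>B. has_ext_gradient (neg_log f) x v}.
              ennreal (norm x powr (q - real CARD('n)) * f x) \<partial>lborel)"

end

theory Submission
  imports Defs
begin

text \<open>On the set \<open>D\<close> of differentiability points of \<open>\<phi> = - ln f\<close> in the interior of \<open>{f > 0}\<close>, the
  gradient of \<open>f\<close> is \<open>- f \<nabla>\<phi>\<close>. Off \<open>D\<close> it is \<open>0\<close>, except possibly on the frontier of the convex set
  \<open>{f > 0}\<close>, which is null. As the dual curvature measure is the image under \<open>\<nabla>\<phi>\<close> of a measure living
  on \<open>D\<close>, the two integrals agree.

  For finiteness, let \<open>\<phi> \<le> M\<close> on the ball of radius \<open>r\<close> about the origin. The subgradient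
  inequality at \<open>r \<nabla>\<phi>(x) / |\<nabla>\<phi>(x)|\<close> gives \<open>r |\<nabla>\<phi>(x)| \<le> M - \<phi>(x) + x \<bullet> \<nabla>\<phi>(x)\<close>. The radial derivative
  \<open>f(x) (x \<bullet> \<nabla>\<phi>(x))\<close> is the limit of \<open>(f(x) - f((1 + t) x)) / t\<close>, and these quotients are bounded below by
  a multiple of \<open>- f\<close>. Since the weight \<open>|x|\<^sup>q\<^sup>-\<^sup>n\<close> is homogeneous, their weighted integrals are
  \<open>(1 - (1 + t)\<^sup>-\<^sup>q) / t \<le> q\<close> times the weighted integral of \<open>f\<close>, which is finite because \<open>f\<close> decays
  exponentially. Fatou's lemma concludes.\<close>

section \<open>Gradients and measurability\<close>

text \<open>Riesz representation: a linear functional on a Euclidean space is the inner product with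
  the vector of its values on the basis.\<close>

lemma differentiable_iff_GDERIV:
  fixes F :: "'a::euclidean_space \<Rightarrow> real"
  shows "F differentiable (at x) \<longleftrightarrow> (\<exists>v. GDERIV F x :> v)"
proof
  assume "F differentiable (at x)"
  then obtain F' where F': "(F has_derivative F') (at x)" by (auto simp: differentiable_def)
  interpret F': bounded_linear F' using F' by (rule has_derivative_bounded_linear)
  define v where "v = (\<Sum>b\<in>Basis. F' b *\<^sub>R b)"
  have "F' = (\<lambda>h. h \<bullet> v)"
  proof
    fix h
    have "F' h = F' (\<Sum>b\<in>Basis. (h \<bullet> b) *\<^sub>R b)" by (simp add: euclidean_representation)
    also have "\<dots> = (\<Sum>b\<in>Basis. (h \<bullet> b) * F' b)" by (simp add: F'.sum F'.scaleR)
    finally show "F' h = h \<bullet> v"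
      by (simp add: v_def inner_sum_right mult.commute)
  qed
  with F' show "\<exists>v. GDERIV F x :> v" by (auto simp: gderiv_def)
qed (auto simp: gderiv_def differentiable_def)

text \<open>Differentiability at \<open>x\<close> means that, for every \<open>k\<close>, some vector \<open>v\<close> of a fixed countable dense set
  approximates \<open>F\<close> near \<open>x\<close> up to a relative error \<open>1 / (k + 1)\<close>, as such vectors form a Cauchy sequence.
  For fixed \<open>v\<close> and radius, this condition on \<open>x\<close> is closed relative to \<open>W\<close>.\<close>

lemma borel_differentiable_points:
  fixes F :: "'a::euclidean_space \<Rightarrow> real"
  assumes W: "open W" and cont: "continuous_on W F"
  shows "{x \<in> W. F differentiable (at x)} \<in> sets borel"
proof -
  obtain V :: "'a set" where V: "countable V" "\<And>X. open X \<Longrightarrow> X \<noteq> {} \<Longrightarrow> \<exists>v\<in>V. v \<in> X"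
    using countable_dense_setE by blast
  \<comment> \<open>At a point of \<open>bad k v h\<close> the vector \<open>v\<close> misses the
    relative error \<open>1 / (k + 1)\<close> for the increment \<open>h\<close>. The strict
    inequality and the condition \<open>x + h \<in> W\<close> make these sets open.\<close>
  define bad where "bad k v h = {x\<in>W. x + h \<in> W \<and> norm h / Suc k < \<bar>F (x + h) - F x - h \<bullet> v\<bar>}" for k :: nat and v h
  have open_bad: "open (bad k v h)" for k v h
  proof -
    let ?W = "W \<inter> (\<lambda>x. x + h) -` W"
    have "open ((\<lambda>x. x + h) -` W)"
      by (intro open_vimage W continuous_intros)
    then have oW: "open ?W" using W by blast
    have "continuous_on ?W (\<lambda>x. x + h)" by (intro continuous_intros)
    then have c1: "continuous_on ?W (\<lambda>x. F (x + h))"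
      by (rule continuous_on_compose2[OF cont]) auto
    have c2: "continuous_on ?W F"
      by (rule continuous_on_subset[OF cont]) auto
    have "continuous_on ?W (\<lambda>x. \<bar>F (x + h) - F x - h \<bullet> v\<bar>)"
      by (rule continuous_on_rabs[OF continuous_on_diff[OF continuous_on_diff[OF c1 c2] continuous_on_const]])
    then have "open (?W \<inter> (\<lambda>x. \<bar>F (x + h) - F x - h \<bullet> v\<bar>) -` {norm h / Suc k<..})"
      by (rule continuous_open_preimage[OF _ oW open_greaterThan])
    moreover have "?W \<inter> (\<lambda>x. \<bar>F (x + h) - F x - h \<bullet> v\<bar>) -` {norm h / Suc k<..} = bad k v h"
      by (auto simp: bad_def)
    ultimately show ?thesis by simp
  qed
  have "{x \<in> W. F differentiable (at x)} =
      (\<Inter>k. \<Union>v\<in>V. \<Union>m::nat. W - (\<Union>h\<in>ball 0 (1 / Suc m). bad k v h))" (is "?L = ?R")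
  proof (intro subset_antisym subsetI)
    fix x assume "x \<in> ?L"
    then obtain v where x: "x \<in> W" and F': "(F has_derivative (\<lambda>h. h \<bullet> v)) (at x)"
      by (auto simp: differentiable_iff_GDERIV gderiv_def)
    show "x \<in> ?R"
    proof
      fix k :: nat
      \<comment> \<open>Half of the permitted error goes to the derivative itself, half to replacing
        \<open>v\<close> by the nearby vector \<open>w\<close> of the dense set.\<close>
      define e where "e = 1 / (2 * real (Suc k))"
      have e: "e > 0" by (simp add: e_def)
      obtain w where w: "w \<in> V" "dist v w < e"
        using V(2)[of "ball v e"] e by fastforce
      obtain d where d: "d > 0" "\<And>y. norm (y - x) < d \<Longrightarrow> norm (F y - F x - (y - x) \<bullet> v) \<le> e * norm (y - x)"
        using F' e unfolding has_derivative_at_alt by blast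
      obtain m where m: "1 / Suc m < d"
        using nat_approx_posE[OF d(1)] by blast
      have "x \<notin> bad k w h" if "h \<in> ball 0 (1 / Suc m)" for h
      proof -
        have "norm h < d" using that m by simp
        then have "\<bar>F (x + h) - F x - h \<bullet> v\<bar> \<le> e * norm h"
          using d(2)[of "x + h"] by simp
        moreover have "\<bar>h \<bullet> v - h \<bullet> w\<bar> \<le> e * norm h"
        proof -
          have "\<bar>h \<bullet> v - h \<bullet> w\<bar> \<le> norm h * norm (v - w)"
            by (metis Cauchy_Schwarz_ineq2 inner_diff_right)
          also have "\<dots> \<le> norm h * e"
            using w(2) by (intro mult_left_mono) (auto simp: dist_norm)
          finally show ?thesis by (simp add: mult.commute)
        qed
        moreover have "norm h / Suc k = 2 * (e * norm h)"
          by (simp add: e_def del: of_nat_Suc)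
        ultimately show ?thesis by (auto simp: bad_def)
      qed
      then show "x \<in> (\<Union>v\<in>V. \<Union>m::nat. W - (\<Union>h\<in>ball 0 (1 / Suc m). bad k v h))"
        using w(1) x by blast
    qed
  next
    fix x assume "x \<in> ?R"
    then have ex: "\<exists>v. \<exists>m::nat. x \<in> W \<and> (\<forall>h\<in>ball 0 (1 / Suc m). x \<notin> bad k v h)" for k
      unfolding INT_iff UN_iff Diff_iff by blast
    then obtain v where "\<And>k. \<exists>m::nat. x \<in> W \<and> (\<forall>h\<in>ball 0 (1 / Suc m). x \<notin> bad k (v k) h)"
      by metis
    then obtain m :: "nat \<Rightarrow> nat" where "\<And>k. x \<in> W \<and> (\<forall>h\<in>ball 0 (1 / Suc (m k)). x \<notin> bad k (v k) h)"
      by metis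
    then have vm: "x \<in> W" "\<And>k h. norm h < 1 / Suc (m k) \<Longrightarrow> x \<notin> bad k (v k) h"
      by auto
    obtain d where d: "d > 0" "ball x d \<subseteq> W" using W vm(1) openE by blast
    define \<delta> where "\<delta> k = min d (1 / Suc (m k))" for k
    have \<delta>: "\<delta> k > 0" for k using d by (simp add: \<delta>_def)
    have est: "\<bar>F (x + h) - F x - h \<bullet> v k\<bar> \<le> norm h / Suc k" if "norm h < \<delta> k" for h k
    proof -
      have "x + h \<in> W" using d(2) that by (auto simp: \<delta>_def dist_norm)
      then show ?thesis using vm(2)[of h k] vm(1) that by (force simp: bad_def \<delta>_def)
    qed
    have diff: "norm (v j - v k) \<le> 1 / Suc j + 1 / Suc k" for j k
    proof (cases "v j = v k")
      case False
      \<comment> \<open>The increment \<open>h\<close> is short enough for both estimates and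
        parallel to \<open>v j - v k\<close>, so that the Cauchy-Schwarz inequality is an equality
        for it.\<close>
      define t where "t = min (\<delta> j) (\<delta> k) / (2 * norm (v j - v k))"
      define h where "h = t *\<^sub>R (v j - v k)"
      have t: "t > 0" using False \<delta> by (simp add: t_def)
      have "norm h = min (\<delta> j) (\<delta> k) / 2" using t False by (simp add: h_def) (simp add: t_def)
      then have "norm h < \<delta> j" "norm h < \<delta> k" using \<delta>[of j] \<delta>[of k] by (auto simp: min_def split: if_splits)
      then have "\<bar>h \<bullet> v j - h \<bullet> v k\<bar> \<le> norm h / Suc j + norm h / Suc k"
        using est[of h j] est[of h k] by linarith
      moreover have "h \<bullet> v j - h \<bullet> v k = norm h * norm (v j - v k)"
        using t power2_norm_eq_inner[of "v j - v k"]
        by (simp add: h_def inner_diff_right right_diff_distrib power2_eq_square mult.assoc)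
      ultimately have "norm h * norm (v j - v k) \<le> norm h * (1 / Suc j + 1 / Suc k)"
        by (simp add: distrib_left)
      then show ?thesis using t False by (simp add: h_def)
    qed simp
    have "Cauchy v"
    proof (rule metric_CauchyI)
      fix e :: real assume "e > 0"
      then obtain N where N: "1 / Suc N < e / 2" by (metis half_gt_zero nat_approx_posE)
      show "\<exists>M. \<forall>m\<ge>M. \<forall>n\<ge>M. dist (v m) (v n) < e"
      proof (intro exI allI impI)
        fix i j assume "i \<ge> N" "j \<ge> N"
        then have "1 / Suc i \<le> 1 / Suc N" "1 / Suc j \<le> 1 / Suc N" by (auto simp: field_simps)
        then show "dist (v i) (v j) < e"
          using diff[of i j] N by (simp add: dist_norm)
      qed
    qed
    then obtain u where u: "v \<longlonglongrightarrow> u" using Cauchy_convergent convergent_def by blast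
    have vu: "norm (v k - u) \<le> 1 / Suc k" for k
    proof (rule LIMSEQ_le)
      show "(\<lambda>j. norm (v k - v j)) \<longlonglongrightarrow> norm (v k - u)" by (intro tendsto_intros u)
      show "(\<lambda>j. 1 / Suc k + 1 / Suc j) \<longlonglongrightarrow> 1 / Suc k"
        using tendsto_add[OF tendsto_const[of "1 / Suc k"] LIMSEQ_inverse_real_of_nat]
        by (simp add: inverse_eq_divide)
      show "\<exists>N. \<forall>n\<ge>N. norm (v k - v n) \<le> 1 / Suc k + 1 / Suc n"
        using diff by blast
    qed
    have "(F has_derivative (\<lambda>h. h \<bullet> u)) (at x)"
      unfolding has_derivative_at_alt
    proof (intro conjI allI impI)
      show "bounded_linear (\<lambda>h. h \<bullet> u)" by (rule bounded_linear_inner_left)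
      fix e :: real assume "e > 0"
      \<comment> \<open>One half of \<open>e\<close> pays for the approximation by
        \<open>v k\<close>, the other for the distance from \<open>v k\<close> to the limit
        \<open>u\<close>.\<close>
      then obtain k where k: "1 / Suc k < e / 2" by (metis half_gt_zero nat_approx_posE)
      show "\<exists>d>0. \<forall>y. norm (y - x) < d \<longrightarrow> norm (F y - F x - (y - x) \<bullet> u) \<le> e * norm (y - x)"
      proof (intro exI conjI allI impI)
        show "\<delta> k > 0" by (rule \<delta>)
        fix y assume y: "norm (y - x) < \<delta> k"
        define h where "h = y - x"
        have "\<bar>F y - F x - h \<bullet> v k\<bar> \<le> norm h * (1 / Suc k)"
          using est[of h k] y by (simp add: h_def)
        moreover have "\<bar>h \<bullet> v k - h \<bullet> u\<bar> \<le> norm h * (1 / Suc k)"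
          using Cauchy_Schwarz_ineq2[of h "v k - u"] mult_left_mono[OF vu[of k], of "norm h"]
          by (simp add: inner_diff_right)
        moreover have "norm h * (1 / Suc k) \<le> norm h * (e / 2)"
          using k by (intro mult_left_mono) auto
        ultimately show "norm (F y - F x - (y - x) \<bullet> u) \<le> e * norm (y - x)"
          unfolding h_def[symmetric] real_norm_def mult.commute[of e] by linarith
      qed
    qed
    then show "x \<in> ?L" using vm(1) by (auto simp: differentiable_def)
  qed
  moreover have "?R \<in> sets borel"
  proof -
    have "W - (\<Union>h\<in>ball 0 (1 / Suc m). bad k v h) \<in> sets borel" for k v and m :: nat
      using W open_bad by (intro sets.Diff borel_open open_UN) auto
    then have "(\<Union>m::nat. W - (\<Union>h\<in>ball 0 (1 / Suc m). bad k v h)) \<in> sets borel" for k v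
      by (intro sets.countable_UN) blast
    then have "(\<Union>v\<in>V. \<Union>m::nat. W - (\<Union>h\<in>ball 0 (1 / Suc m). bad k v h)) \<in> sets borel" for k
      using V(1) by (intro sets.countable_UN') blast+
    then show ?thesis
      by (intro sets.countable_INT) blast+
  qed
  ultimately show ?thesis by (simp only:)
qed

lemma GDERIV_unique:
  assumes "GDERIV F x :> u" "GDERIV F x :> v"
  shows "u = v"
proof -
  have "h \<bullet> u = h \<bullet> v" for h
    using has_derivative_unique[OF assms[unfolded gderiv_def]] by (rule fun_cong)
  then show ?thesis by (rule vector_eq_ldot[THEN iffD1, rule_format])
qed

lemma GDERIV_transform_open:
  assumes "open S" "x \<in> S" "GDERIV F x :> v" "\<And>y. y \<in> S \<Longrightarrow> F y = H y"
  shows "GDERIV H x :> v"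
  using has_derivative_transform_within_open[OF assms(3)[unfolded gderiv_def] assms(1,2,4)]
  by (simp only: gderiv_def)

lemma GDERIV_directional:
  assumes "GDERIV F x :> v"
  shows "((\<lambda>t. (F (x + t *\<^sub>R h) - F x) / t) \<longlongrightarrow> h \<bullet> v) (at 0)"
proof -
  have "((\<lambda>t. x + t *\<^sub>R h) has_derivative (\<lambda>t. t *\<^sub>R h)) (at 0)"
    by (auto intro!: derivative_eq_intros)
  moreover have "(F has_derivative (\<lambda>h. h \<bullet> v)) (at (x + 0 *\<^sub>R h))"
    using assms by (simp add: gderiv_def)
  ultimately have "((\<lambda>t. F (x + t *\<^sub>R h)) has_derivative (\<lambda>t. (t *\<^sub>R h) \<bullet> v)) (at 0)"
    by (rule has_derivative_compose)
  then have "((\<lambda>t. F (x + t *\<^sub>R h)) has_field_derivative (h \<bullet> v)) (at 0)"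
    by (simp add: has_field_derivative_def mult_commute_abs)
  then show ?thesis by (simp add: DERIV_def)
qed

text \<open>Each coordinate is a pointwise limit of measurable difference quotients with increments
  \<open>1 / (k + 1)\<close>. The indicator of \<open>D\<close> makes the sequence converge off
  \<open>D\<close> as well, to the value \<open>0\<close> of \<open>G\<close>.\<close>

lemma borel_measurable_gradient_on:
  fixes F :: "'a::euclidean_space \<Rightarrow> real" and G :: "'a \<Rightarrow> 'a"
  assumes [measurable]: "F \<in> borel_measurable borel" "D \<in> sets borel"
    and G: "\<And>x. x \<in> D \<Longrightarrow> GDERIV F x :> G x" "\<And>x. x \<notin> D \<Longrightarrow> G x = 0"
  shows "G \<in> borel_measurable borel"
proof -
  have "(\<lambda>x. G x \<bullet> b) \<in> borel_measurable borel" for b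
  proof (rule borel_measurable_LIMSEQ_real)
    fix x :: 'a
    show "(\<lambda>k. indicator D x * ((F (x + (1 / Suc k) *\<^sub>R b) - F x) / (1 / Suc k))) \<longlonglongrightarrow> G x \<bullet> b"
    proof (cases "x \<in> D")
      case True
      have lim: "filterlim (\<lambda>k. 1 / Suc k) (at 0) sequentially"
        using LIMSEQ_inverse_real_of_nat by (simp add: filterlim_at inverse_eq_divide)
      show ?thesis
        using filterlim_compose[OF GDERIV_directional[OF G(1)[OF True], of b] lim] True
        by (simp add: inner_commute)
    qed (simp add: G)
  qed measurable
  then show ?thesis by (rule borel_measurable_euclidean_space[THEN iffD2, rule_format])
qed

section \<open>Radial weights\<close>

lemma nn_integral_lborel_scaleR:
  fixes g :: "'a::euclidean_space \<Rightarrow> ennreal"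
  assumes [measurable]: "g \<in> borel_measurable borel" and c: "c \<noteq> 0"
  shows "(\<integral>\<^sup>+x. g x \<partial>lborel) = ennreal (\<bar>c\<bar> ^ DIM('a)) * (\<integral>\<^sup>+x. g (c *\<^sub>R x) \<partial>lborel)"
  by (subst lborel_affine[OF c, of 0])
     (simp add: nn_integral_density nn_integral_distr nn_integral_cmult)

text \<open>In polar coordinates the density becomes \<open>r powr (p - 1)\<close> times the surface
  measure of the unit sphere. The exponent is normalised so that dilation by \<open>r\<close>
  multiplies the measure by \<open>r powr p\<close>.\<close>

definition radial_measure :: "real \<Rightarrow> 'a::euclidean_space measure" where
  "radial_measure p = density lborel (\<lambda>x. ennreal (norm x powr (p - real DIM('a))))"

definition annulus :: "real \<Rightarrow> 'a::euclidean_space set" where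
  "annulus r = {x. r \<le> norm x \<and> norm x < 2 * r}"

lemma sets_radial_measure [simp, measurable_cong]: "sets (radial_measure p) = sets borel"
  by (simp add: radial_measure_def)

lemma annulus_borel [measurable]: "annulus r \<in> sets borel"
  unfolding annulus_def by measurable

text \<open>Dilation by \<open>r\<close> carries \<open>annulus 1\<close> onto
  \<open>annulus r\<close>. Lebesgue measure contributes the \<open>n\<close>-th power of
  \<open>r\<close>, where \<open>n\<close> is the dimension, and the weight contributes
  \<open>r powr (p - n)\<close>.\<close>

lemma emeasure_radial_annulus:
  assumes r: "r > 0"
  shows "emeasure (radial_measure p) (annulus r :: 'a::euclidean_space set) =
    ennreal (r powr p) * emeasure (radial_measure p) (annulus 1 :: 'a set)"
proof -
  let ?w = "\<lambda>x::'a. ennreal (norm x powr (p - real DIM('a)))"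
  have ind: "indicator (annulus r) (r *\<^sub>R x) = (indicator (annulus 1) x :: ennreal)" for x :: 'a
    using r by (auto simp: annulus_def indicator_def)
  have "emeasure (radial_measure p) (annulus r :: 'a set) = (\<integral>\<^sup>+x. ?w x * indicator (annulus r) x \<partial>lborel)"
    by (simp add: radial_measure_def emeasure_density)
  also have "\<dots> = ennreal (\<bar>r\<bar> ^ DIM('a)) * (\<integral>\<^sup>+x. ?w (r *\<^sub>R x) * indicator (annulus r) (r *\<^sub>R x) \<partial>lborel)"
    using r by (subst nn_integral_lborel_scaleR[of _ r]) auto
  also have "(\<integral>\<^sup>+x. ?w (r *\<^sub>R x) * indicator (annulus r) (r *\<^sub>R x) \<partial>lborel) =
      (\<integral>\<^sup>+x. ennreal (r powr (p - real DIM('a))) * (?w x * indicator (annulus 1) x) \<partial>lborel)"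
    unfolding ind using r by (simp add: powr_mult ennreal_mult mult.assoc)
  also have "\<dots> = ennreal (r powr (p - real DIM('a))) * emeasure (radial_measure p) (annulus 1 :: 'a set)"
    by (subst nn_integral_cmult) (simp_all add: radial_measure_def emeasure_density)
  also have "ennreal (\<bar>r\<bar> ^ DIM('a)) * (ennreal (r powr (p - real DIM('a))) * emeasure (radial_measure p) (annulus 1 :: 'a set)) =
      ennreal (r powr p) * emeasure (radial_measure p) (annulus 1 :: 'a set)"
  proof -
    have "\<bar>r\<bar> ^ DIM('a) * r powr (p - real DIM('a)) = r powr p"
      using r by (simp add: powr_realpow[symmetric] powr_add[symmetric])
    then show ?thesis by (simp add: mult.assoc[symmetric] ennreal_mult[symmetric])
  qed
  finally show ?thesis .
qed

lemma emeasure_radial_annulus_finite: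
  "emeasure (radial_measure p) (annulus 1 :: 'a::euclidean_space set) < \<infinity>"
proof -
  let ?a = "p - real DIM('a)"
  \<comment> \<open>The absolute value of the exponent treats increasing and decreasing weights at
    once, since \<open>1 \<le> norm x < 2\<close> on the shell.\<close>
  have "norm x powr ?a \<le> 2 powr \<bar>?a\<bar>" if "x \<in> annulus 1" for x :: 'a
  proof -
    have "norm x powr ?a \<le> norm x powr \<bar>?a\<bar>"
      using that by (intro powr_mono) (auto simp: annulus_def)
    also have "\<dots> \<le> 2 powr \<bar>?a\<bar>"
      using that by (intro powr_mono2) (auto simp: annulus_def)
    finally show ?thesis .
  qed
  then have "emeasure (radial_measure p) (annulus 1 :: 'a set) \<le>
      (\<integral>\<^sup>+x. ennreal (2 powr \<bar>?a\<bar>) * indicator (ball 0 2 :: 'a set) x \<partial>lborel)"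
    unfolding radial_measure_def
    by (subst emeasure_density; (intro nn_integral_mono)?)
       (auto simp: annulus_def indicator_def intro!: ennreal_leI)
  also have "\<dots> = ennreal (2 powr \<bar>?a\<bar>) * emeasure lborel (ball 0 2 :: 'a set)"
    by (subst nn_integral_cmult_indicator) auto
  also have "\<dots> < \<infinity>"
    using emeasure_lborel_ball_finite[of "0::'a" 2] by (simp add: ennreal_mult_less_top)
  finally show ?thesis .
qed

text \<open>By homogeneity the shells have measure \<open>r k powr p\<close> times one finite
  constant, and countable subadditivity reduces the claim to the series.\<close>

lemma emeasure_radial_UN_annulus_finite:
  fixes r :: "nat \<Rightarrow> real"
  assumes r: "\<And>k. r k > 0" and sm: "summable (\<lambda>k. r k powr p)"
  shows "emeasure (radial_measure p) (\<Union>k. annulus (r k) :: 'a::euclidean_space set) < \<infinity>"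
proof -
  let ?K = "emeasure (radial_measure p) (annulus 1 :: 'a set)"
  have "emeasure (radial_measure p) (\<Union>k. annulus (r k) :: 'a set)
      \<le> (\<Sum>k. emeasure (radial_measure p) (annulus (r k) :: 'a set))"
    by (intro emeasure_subadditive_countably) auto
  also have "\<dots> = (\<Sum>k. ennreal (r k powr p) * ?K)"
    by (simp add: emeasure_radial_annulus[OF r])
  also have "\<dots> = (\<Sum>k. ennreal (r k powr p)) * ?K"
    by simp
  also have "(\<Sum>k. ennreal (r k powr p)) = ennreal (\<Sum>k. r k powr p)"
    using sm by (intro suminf_ennreal2) auto
  also have "\<dots> * ?K < \<infinity>"
    using emeasure_radial_annulus_finite[where 'a='a, of p] by (simp add: ennreal_mult_less_top)
  finally show ?thesis .
qed

text \<open>The exponent is the integer part of the binary logarithm of \<open>t\<close>, found as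
  the predecessor of the least \<open>m\<close> with \<open>t < 2 ^ m\<close>.\<close>

lemma dyadic_scale:
  fixes t :: real
  assumes "1 \<le> t"
  obtains k :: nat where "2 ^ k \<le> t" "t < 2 * 2 ^ k"
proof -
  obtain m where m: "t < 2 ^ m" using real_arch_pow[of 2 t] by auto
  define j where "j = (LEAST m. t < 2 ^ m)"
  have j: "t < 2 ^ j" unfolding j_def using m by (rule LeastI)
  with assms have "j \<noteq> 0" by (intro notI) simp
  then obtain k where k: "j = Suc k" by (cases j) auto
  have "\<not> t < 2 ^ k" using not_less_Least[of k "\<lambda>m. t < 2 ^ m"] k by (simp add: j_def)
  with j k show ?thesis by (intro that[of k]) auto
qed

text \<open>The shells with inner radii \<open>(1/2) ^ (k + 1)\<close> cover the punctured ball, and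
  their measures form a geometric series of ratio \<open>(1/2) powr q\<close>, which is less than
  \<open>1\<close> as \<open>q > 0\<close>.\<close>

lemma emeasure_radial_punctured_ball:
  assumes "q > 0"
  shows "emeasure (radial_measure q) (ball 0 1 - {0} :: 'a::euclidean_space set) < \<infinity>"
proof -
  define r :: "nat \<Rightarrow> real" where "r k = (1/2) ^ Suc k" for k
  have "ball 0 1 - {0} \<subseteq> (\<Union>k. annulus (r k) :: 'a set)"
  proof
    fix x :: 'a assume "x \<in> ball 0 1 - {0}"
    then have x: "0 < norm x" "norm x < 1" by auto
    then have "1 \<le> 1 / norm x" by (simp add: field_simps)
    then obtain k where k: "2 ^ k \<le> 1 / norm x" "1 / norm x < 2 * 2 ^ k" by (rule dyadic_scale)
    show "x \<in> (\<Union>k. annulus (r k))"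
    \<comment> \<open>Inverting the dyadic bounds gives \<open>r k < norm x \<le> 2 * r k\<close>,
      whereas a shell contains its inner sphere and not its outer one. A point of the outer sphere
      therefore belongs to the preceding shell.\<close>
    proof (cases "norm x = 2 * r k")
      case True
      then have "k \<noteq> 0" using x(2) by (intro notI) (simp add: r_def)
      then obtain j where "k = Suc j" by (cases k) auto
      with True have "norm x = r j" by (simp add: r_def)
      with x(1) have "x \<in> annulus (r j)" by (simp add: annulus_def)
      then show ?thesis by blast
    next
      case False
      then have "x \<in> annulus (r k)"
        using k x by (auto simp: annulus_def r_def field_simps)
      then show ?thesis by blast
    qed
  qed
  then have "emeasure (radial_measure q) (ball 0 1 - {0} :: 'a set) \<le> emeasure (radial_measure q) (\<Union>k. annulus (r k) :: 'a set)"
    by (intro emeasure_mono) auto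
  also have "\<dots> < \<infinity>"
  proof (rule emeasure_radial_UN_annulus_finite)
    have eq: "r k powr q = (1/2) powr q * ((1/2) powr q) ^ k" for k
    proof -
      have "r k powr q = (1/2) powr (real (Suc k) * q)"
        unfolding r_def by (subst powr_realpow[symmetric]) (simp, rule powr_powr)
      also have "\<dots> = (1/2) powr q * (1/2) powr (q * real k)"
        by (simp add: powr_add[symmetric] algebra_simps)
      also have "(1/2) powr (q * real k) = ((1/2::real) powr q) ^ k"
        by (simp add: powr_powr[symmetric] powr_realpow)
      finally show ?thesis .
    qed
    have "(1/2) powr q < (1::real)" using powr_less_mono2[of q "1/2" 1] assms by simp
    then have "norm ((1/2) powr q) < (1::real)" by simp
    then show "summable (\<lambda>k. r k powr q)"
      unfolding eq by (intro summable_mult summable_geometric)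
  qed (simp add: r_def)
  finally show ?thesis .
qed

text \<open>A negative exponent gives a finite measure at infinity, by summing over the shells of
  inner radius \<open>2 ^ k\<close>. The value \<open>-1\<close> is a convenient choice.\<close>

lemma emeasure_radial_exterior:
  "emeasure (radial_measure (-1)) (- ball 0 1 :: 'a::euclidean_space set) < \<infinity>"
proof -
  have "- ball 0 1 \<subseteq> (\<Union>k. annulus (2 ^ k) :: 'a set)"
  proof
    fix x :: 'a assume "x \<in> - ball 0 1"
    then have "1 \<le> norm x" by auto
    then obtain k where "2 ^ k \<le> norm x" "norm x < 2 * 2 ^ k" by (rule dyadic_scale)
    then show "x \<in> (\<Union>k. annulus (2 ^ k))" by (auto simp: annulus_def)
  qed
  then have "emeasure (radial_measure (-1)) (- ball 0 1 :: 'a set) \<le> emeasure (radial_measure (-1)) (\<Union>k. annulus (2 ^ k) :: 'a set)"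
    by (intro emeasure_mono) auto
  also have "\<dots> < \<infinity>"
  proof (rule emeasure_radial_UN_annulus_finite)
    have eq: "(2 ^ k) powr - 1 = (1/2::real) ^ k" for k
      by (simp add: powr_minus power_divide field_simps)
    show "summable (\<lambda>k. (2 ^ k) powr (- 1 :: real))"
      unfolding eq by (intro summable_geometric) simp
  qed simp
  finally show ?thesis .
qed

text \<open>The constant is the exponential of the maximum of \<open>a * ln t - c * t\<close>,
  attained at \<open>t = a / c\<close>.\<close>

lemma powr_le_exp:
  fixes t a c :: real
  assumes "t > 0" "a > 0" "c > 0"
  shows "t powr a \<le> exp (a * ln (a / c) - a) * exp (c * t)"
proof -
  have "ln (t * c / a) \<le> t * c / a - 1"
    using assms by (intro ln_le_minus_one) auto
  then have "ln t \<le> t * c / a - 1 + ln (a / c)"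
    using assms by (simp add: ln_mult ln_div)
  then have "a * ln t \<le> a * (t * c / a - 1 + ln (a / c))"
    using assms by simp
  also have "\<dots> = a * ln (a / c) - a + c * t"
    using assms by (simp add: algebra_simps)
  finally show ?thesis
    using assms by (simp add: powr_def exp_add[symmetric])
qed

text \<open>Inside the unit ball \<open>g\<close> is bounded and the weight is integrable because
  \<open>q > 0\<close>. Outside, part of the weight, \<open>norm x powr (q + 1)\<close>, is absorbed
  by the exponential, which leaves the integrable weight of exponent \<open>-1\<close>.\<close>

lemma nn_integral_radial_exp_decay:
  fixes g :: "'a::euclidean_space \<Rightarrow> real"
  assumes q: "q > 0" and c: "c > 0" and A: "A \<ge> 0"
    and g: "\<And>x. 0 \<le> g x" "\<And>x. g x \<le> A * exp (- c * norm x)"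
  shows "(\<integral>\<^sup>+x. ennreal (norm x powr (q - real DIM('a)) * g x) \<partial>lborel) < \<infinity>"
proof -
  let ?n = "real DIM('a)"
  have [measurable]: "ball 0 1 - {0} \<in> sets (borel :: 'a measure)" "- ball 0 1 \<in> sets (borel :: 'a measure)"
    by auto
  define K where "K = exp ((q + 1) * ln ((q + 1) / c) - (q + 1))"
  have K: "K \<ge> 0" by (simp add: K_def)
  have bound: "ennreal (norm x powr (q - ?n) * g x) \<le>
      ennreal A * (ennreal (norm x powr (q - ?n)) * indicator (ball 0 1 - {0}) x) +
      ennreal (A * K) * (ennreal (norm x powr (- 1 - ?n)) * indicator (- ball 0 1) x)" for x :: 'a
  proof (cases "norm x < 1")
    case True
    have "g x \<le> A" using g(2)[of x] A c by (smt (verit) exp_le_one_iff mult_left_le mult_nonneg_nonneg norm_ge_zero mult_minus_left)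
    then have "norm x powr (q - ?n) * g x \<le> A * norm x powr (q - ?n)"
      by (subst mult.commute) (intro mult_right_mono, auto)
    \<comment> \<open>At the origin both sides vanish, as \<open>0 powr a = 0\<close>; hence the
      punctured ball suffices.\<close>
    then show ?thesis
      using True A by (cases "x = 0") (auto simp: indicator_def ennreal_mult[symmetric] intro!: ennreal_leI)
  next
    case False
    have "norm x powr (q - ?n) * g x \<le> norm x powr (q - ?n) * (A * exp (- c * norm x))"
      by (intro mult_left_mono g) auto
    also have "\<dots> = norm x powr (- 1 - ?n) * norm x powr (q + 1) * (A * exp (- c * norm x))"
      by (simp add: powr_add[symmetric])
    also have "\<dots> \<le>
        norm x powr (- 1 - ?n) * (K * exp (c * norm x)) * (A * exp (- c * norm x))"
    proof (intro mult_right_mono mult_left_mono)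
      have "norm x > 0" using False by linarith
      then show "norm x powr (q + 1) \<le> K * exp (c * norm x)"
        unfolding K_def using q c by (intro powr_le_exp) auto
    qed (use A in auto)
    also have "\<dots> = A * K * norm x powr (- 1 - ?n) * (exp (c * norm x) * exp (- c * norm x))"
      by (simp only: mult_ac)
    also have "\<dots> = A * K * norm x powr (- 1 - ?n)" by (simp add: exp_add[symmetric])
    finally have "norm x powr (q - ?n) * g x \<le> A * K * norm x powr (- 1 - ?n)" .
    then show ?thesis
      using False A K by (auto simp: indicator_def ennreal_mult[symmetric] intro!: ennreal_leI)
  qed
  have "(\<integral>\<^sup>+x. ennreal (norm x powr (q - ?n) * g x) \<partial>lborel) \<le>
      (\<integral>\<^sup>+x. ennreal A * (ennreal (norm x powr (q - ?n)) * indicator (ball 0 1 - {0}) (x::'a)) +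
      ennreal (A * K) * (ennreal (norm x powr (- 1 - ?n)) * indicator (- ball 0 1) x) \<partial>lborel)"
    by (intro nn_integral_mono bound)
  also have "\<dots> = ennreal A * emeasure (radial_measure q) (ball 0 1 - {0} :: 'a set) +
      ennreal (A * K) * emeasure (radial_measure (- 1)) (- ball 0 1 :: 'a set)"
    by (subst nn_integral_add, measurable) (simp add: nn_integral_cmult radial_measure_def emeasure_density)
  also have "\<dots> < \<infinity>"
    using emeasure_radial_punctured_ball[OF q, where 'a='a] emeasure_radial_exterior[where 'a='a]
    by (simp add: ennreal_mult_less_top)
  finally show ?thesis .
qed

section \<open>Log-concave functions\<close>

text \<open>If \<open>x \<in> K\<close> is far away, the convex hull of \<open>x\<close> and the ball contains many disjoint balls of radius
  \<open>\<rho> / 2\<close>, centred on the half of the segment from \<open>0\<close> to \<open>x\<close> that is nearer to \<open>0\<close>.\<close>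

lemma bounded_convex_finite_measure:
  fixes K :: "'a::euclidean_space set"
  assumes K: "convex K" "K \<in> sets borel" "emeasure lborel K < \<infinity>" and \<rho>: "\<rho> > 0" "ball 0 \<rho> \<subseteq> K"
  shows "bounded K"
proof (rule ccontr)
  assume unb: "\<not> bounded K"
  define m where "m = unit_ball_vol (real DIM('a)) * (\<rho> / 2) ^ DIM('a)"
  have m: "m > 0" using \<rho> by (simp add: m_def)
  have ball: "emeasure lborel (ball c (\<rho> / 2) :: 'a set) = ennreal m" for c
    using \<rho> by (simp add: emeasure_ball m_def)
  have le: "ennreal (real N * m) \<le> emeasure lborel K" for N :: nat
  proof -
    obtain x where x: "x \<in> K" "norm x > 2 * N * \<rho>"
      \<comment> \<open>The bound \<open>2 * N * \<rho>\<close> leaves room for \<open>N\<close>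
        centres, spaced by \<open>\<rho>\<close>, on the half of the segment nearer to
        \<open>0\<close>.\<close>
      using unb unfolding bounded_iff by (meson not_le)
    have nx: "norm x > 0" using x(2) \<rho> by (smt (verit) mult_nonneg_nonneg of_nat_0_le_iff)
    define c where "c j = (real j * \<rho> / norm x) *\<^sub>R x" for j :: nat
    have sub: "ball (c j) (\<rho> / 2) \<subseteq> K" if j: "j < N" for j
    proof
      fix y assume y: "y \<in> ball (c j) (\<rho> / 2)"
      define t where "t = real j * \<rho> / norm x"
      have "real j * \<rho> \<le> real N * \<rho>" using j \<rho> by simp
      then have "real j * \<rho> / norm x \<le> 1 / 2"
        using nx x(2) by (simp add: divide_le_eq)
      then have t: "0 \<le> t" "t \<le> 1 / 2"
        using nx \<rho> by (auto simp: t_def)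
      \<comment> \<open>This solves \<open>y = t x + (1 - t) z\<close> for \<open>z\<close>. As
        \<open>t \<le> 1 / 2\<close>, division by \<open>1 - t\<close> at most doubles the distance
        \<open>\<rho> / 2\<close>, so \<open>z\<close> stays in the ball of radius
        \<open>\<rho>\<close>.\<close>
      define z where "z = (1 / (1 - t)) *\<^sub>R (y - t *\<^sub>R x)"
      have "norm (y - t *\<^sub>R x) < \<rho> / 2"
        using y by (simp add: c_def t_def dist_norm norm_minus_commute)
      also have "\<rho> / 2 \<le> (1 - t) * \<rho>" using t \<rho> by (simp add: field_simps)
      finally have "norm (y - t *\<^sub>R x) / (1 - t) < \<rho>" using t by (simp add: divide_less_eq mult.commute)
      then have "norm z < \<rho>" using t by (simp add: z_def)
      then have "z \<in> K" using \<rho> by auto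
      then have "t *\<^sub>R x + (1 - t) *\<^sub>R z \<in> K"
        using K(1) x(1) t by (intro convexD) auto
      moreover have "t *\<^sub>R x + (1 - t) *\<^sub>R z = y" using t by (simp add: z_def)
      ultimately show "y \<in> K" by simp
    qed
    have disj: "disjoint_family_on (\<lambda>j. ball (c j) (\<rho> / 2)) {..<N}"
      unfolding disjoint_family_on_def
    proof (intro ballI impI)
      fix i j assume "i \<noteq> (j::nat)"
      then have "1 \<le> \<bar>real i - real j\<bar>" by linarith
      moreover have "dist (c i) (c j) = \<bar>real i - real j\<bar> * \<rho>"
      proof -
        have "c i - c j = ((real i - real j) * \<rho> / norm x) *\<^sub>R x"
          by (simp add: c_def scaleR_left_diff_distrib[symmetric] left_diff_distrib diff_divide_distrib)
        then show ?thesis using nx \<rho> by (simp add: dist_norm abs_mult)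
      qed
      ultimately have "dist (c i) (c j) \<ge> \<rho> / 2 + \<rho> / 2"
        using \<rho> by simp
      then show "ball (c i) (\<rho> / 2) \<inter> ball (c j) (\<rho> / 2) = {}"
        by (intro disjoint_ballI)
    qed
    have "ennreal (real N * m) = (\<Sum>j<N. emeasure lborel (ball (c j) (\<rho> / 2)))"
      using m by (simp add: ball ennreal_mult ennreal_of_nat_eq_real_of_nat)
    also have "\<dots> = emeasure lborel (\<Union>j<N. ball (c j) (\<rho> / 2))"
      using disj by (intro sum_emeasure) auto
    also have "\<dots> \<le> emeasure lborel K"
      using sub K(2) by (intro emeasure_mono) auto
    finally show ?thesis .
  qed
  obtain b where b: "emeasure lborel K = ennreal b" "b \<ge> 0"
    using K(3) by (cases "emeasure lborel K") auto
  obtain N :: nat where "b / m < N" using reals_Archimedean2 by blast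
  then have "b < real N * m" using m by (simp add: field_simps)
  moreover have "real N * m \<le> b" using le[of N] b m by simp
  ultimately show False by simp
qed

text \<open>Subgradient inequality: by convexity the difference quotients along the segment from
  \<open>x\<close> to \<open>y\<close> are at most \<open>F y - F x\<close>, and they tend to the
  directional derivative.\<close>

lemma convex_on_gradient_le:
  assumes conv: "convex_on S F" and x: "x \<in> S" "GDERIV F x :> v" and y: "y \<in> S"
  shows "F x + (y - x) \<bullet> v \<le> F y"
proof -
  have "((\<lambda>t. (F (x + t *\<^sub>R (y - x)) - F x) / t) \<longlongrightarrow> (y - x) \<bullet> v) (at_right 0)"
    using GDERIV_directional[OF x(2)] by (rule tendsto_within_subset) auto
  moreover have "\<forall>\<^sub>F t in at_right 0. (F (x + t *\<^sub>R (y - x)) - F x) / t \<le> F y - F x"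
  proof -
    have "\<forall>\<^sub>F t in at_right 0. t \<in> {0<..<1::real}"
      by (rule eventually_at_right_real) simp
    then show ?thesis
    proof eventually_elim
      case (elim t)
      have "F ((1 - t) *\<^sub>R x + t *\<^sub>R y) \<le> (1 - t) * F x + t * F y"
        using elim by (intro convex_onD[OF conv] x y) auto
      moreover have "(1 - t) *\<^sub>R x + t *\<^sub>R y = x + t *\<^sub>R (y - x)"
        by (simp add: algebra_simps)
      ultimately show ?case using elim by (simp add: field_simps)
    qed
  qed
  ultimately have "(y - x) \<bullet> v \<le> F y - F x"
    by (rule tendsto_upperbound) simp
  then show ?thesis by simp
qed

text \<open>This distils from \<open>LC\<close> what the analysis uses, with real values only:
  convexity is stated on the set where \<open>f\<close> is positive and \<open>- ln (f x)\<close> is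
  the true exponent.\<close>

locale log_concave =
  fixes f :: "'a::euclidean_space \<Rightarrow> real"
  assumes borel [measurable]: "f \<in> borel_measurable borel"
    and nonneg: "0 \<le> f x"
    and conv: "convex_on {x. 0 < f x} (\<lambda>x. - ln (f x))"
begin

abbreviation \<phi> :: "'a \<Rightarrow> real" where "\<phi> x \<equiv> - ln (f x)"

abbreviation dom :: "'a set" where "dom \<equiv> {x. 0 < f x}"

lemma eq_0_outside_dom: "x \<notin> dom \<Longrightarrow> f x = 0"
  using nonneg[of x] by simp

lemma convex_dom: "convex dom"
  using conv by (rule convex_on_imp_convex)

lemma continuous_interior: "continuous_on (interior dom) \<phi>"
  by (intro convex_on_continuous convex_on_subset[OF conv] convex_interior convex_dom interior_subset) simp

lemma GDERIV_of_neg_log: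
  assumes x: "x \<in> interior dom" and v: "GDERIV \<phi> x :> v"
  shows "GDERIV f x :> - f x *\<^sub>R v"
proof (rule GDERIV_transform_open[OF open_interior x])
  have "x \<in> dom" using x interior_subset[of dom] by blast
  then show "GDERIV (\<lambda>y. exp (- \<phi> y)) x :> - f x *\<^sub>R v"
    using GDERIV_DERIV_compose[OF GDERIV_minus[OF v] DERIV_exp] by simp
  show "exp (- \<phi> y) = f y" if "y \<in> interior dom" for y
    using that interior_subset[of dom] by auto
qed

text \<open>Chain rule through \<open>ln\<close>, valid since \<open>f x > 0\<close>. With
  \<open>GDERIV_of_neg_log\<close> it shows that \<open>f\<close> and \<open>\<phi>\<close> have the
  same points of differentiability in \<open>interior dom\<close>.\<close>

lemma neg_log_differentiable:
  assumes x: "x \<in> interior dom" and v: "GDERIV f x :> v"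
  shows "\<exists>u. GDERIV \<phi> x :> u"
proof -
  have "x \<in> dom" using x interior_subset[of dom] by blast
  then show ?thesis
    using GDERIV_minus[OF GDERIV_DERIV_compose[OF v DERIV_ln]] by blast
qed

end

section \<open>Exponential decay about an interior origin\<close>

locale log_concave_at_0 = log_concave +
  assumes integrable: "(\<integral>\<^sup>+x. ennreal (f x) \<partial>lborel) < \<infinity>"
    and origin: "0 \<in> interior {x. 0 < f x}"
begin

lemma f_0_pos: "0 < f 0"
  using origin interior_subset by blast

text \<open>The point \<open>x\<close> lies on the segment from \<open>0\<close> to
  \<open>s x\<close> at parameter \<open>1 / s\<close>; the convexity inequality there is multiplied
  by \<open>s\<close>. It serves both for the decay of \<open>f\<close> and for comparing
  \<open>f\<close> with its dilates.\<close>

lemma neg_log_ray: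
  assumes s: "s \<ge> 1" and x: "s *\<^sub>R x \<in> dom"
  shows "x \<in> dom" "s * \<phi> x - (s - 1) * \<phi> 0 \<le> \<phi> (s *\<^sub>R x)"
proof -
  have eq: "(1 - 1/s) *\<^sub>R 0 + (1/s) *\<^sub>R (s *\<^sub>R x) = x" using s by simp
  have "(1 - 1/s) *\<^sub>R 0 + (1/s) *\<^sub>R (s *\<^sub>R x) \<in> dom"
    using s x f_0_pos by (intro convexD[OF convex_dom]) auto
  then show "x \<in> dom" using eq by simp
  have "\<phi> ((1 - 1/s) *\<^sub>R 0 + (1/s) *\<^sub>R (s *\<^sub>R x)) \<le> (1 - 1/s) * \<phi> 0 + (1/s) * \<phi> (s *\<^sub>R x)"
    using s x f_0_pos by (intro convex_onD[OF conv]) auto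
  then have "\<phi> x \<le> (1 - 1/s) * \<phi> 0 + (1/s) * \<phi> (s *\<^sub>R x)"
    unfolding eq .
  then have "s * \<phi> x \<le> s * ((1 - 1/s) * \<phi> 0 + (1/s) * \<phi> (s *\<^sub>R x))"
    using s by (intro mult_left_mono) auto
  also have "\<dots> = (s - 1) * \<phi> 0 + \<phi> (s *\<^sub>R x)" using s by (simp add: field_simps)
  finally show "s * \<phi> x - (s - 1) * \<phi> 0 \<le> \<phi> (s *\<^sub>R x)" by simp
qed

lemma locally_bounded:
  obtains r M where "r > 0" "cball 0 r \<subseteq> dom" "\<And>y. y \<in> cball 0 r \<Longrightarrow> \<phi> y \<le> M"
proof -
  obtain r where r: "r > 0" "cball 0 r \<subseteq> interior dom"
    using origin open_contains_cball[of "interior dom"] by auto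
  have "compact (\<phi> ` cball 0 r)"
    by (intro compact_continuous_image continuous_on_subset[OF continuous_interior r(2)] compact_cball)
  then obtain M where M: "\<forall>z\<in>\<phi> ` cball 0 r. norm z \<le> M"
    using compact_imp_bounded bounded_iff by meson
  show ?thesis
  proof (rule that[OF r(1)])
    show "cball 0 r \<subseteq> dom" using r(2) interior_subset[of dom] by blast
    fix y :: 'a assume "y \<in> cball 0 r"
    then have "norm (\<phi> y) \<le> M" using M by blast
    then show "\<phi> y \<le> M" unfolding real_norm_def by linarith
  qed
qed

text \<open>The sublevel set \<open>K\<close> is convex. It has finite measure because
  \<open>f\<close> is integrable and bounded below on it by a positive constant, and by continuity
  it contains a ball about \<open>0\<close>. Hence it is bounded.\<close>

lemma level_set_bounded:
  obtains R where "R > 0" "\<And>x. R \<le> norm x \<Longrightarrow> x \<in> dom \<Longrightarrow> \<phi> 0 + 1 \<le> \<phi> x"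
proof -
  define K where "K = {x \<in> dom. \<phi> x < \<phi> 0 + 1}"
  have "convex K"
  proof (rule convexI)
    fix x y and u v :: real
    assume xy: "x \<in> K" "y \<in> K" and uv: "0 \<le> u" "0 \<le> v" "u + v = 1"
    then have "x \<in> dom" "y \<in> dom" by (auto simp: K_def)
    then have "\<phi> (u *\<^sub>R x + v *\<^sub>R y) \<le> u * \<phi> x + v * \<phi> y"
      using conv uv unfolding convex_on_def by blast
    also have "\<dots> < \<phi> 0 + 1"
      using xy uv by (intro convex_bound_lt) (auto simp: K_def)
    finally show "u *\<^sub>R x + v *\<^sub>R y \<in> K"
      using convexD[OF convex_dom \<open>x \<in> dom\<close> \<open>y \<in> dom\<close> uv] by (simp add: K_def)
  qed
  have K_borel: "K \<in> sets borel"
    unfolding K_def by measurable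
  have "emeasure lborel K < \<infinity>"
  proof -
    define b where "b = exp (- (\<phi> 0 + 1))"
    have b: "b > 0" by (simp add: b_def)
    have "b \<le> f x" if "x \<in> K" for x
    proof -
      have "- (\<phi> 0 + 1) \<le> - \<phi> x" using that by (simp add: K_def)
      then have "b \<le> exp (- \<phi> x)" unfolding b_def by (simp only: exp_le_cancel_iff)
      also have "\<dots> = f x" using that by (simp add: K_def)
      finally show ?thesis .
    qed
    then have "(\<integral>\<^sup>+x. ennreal b * indicator K x \<partial>lborel) \<le> (\<integral>\<^sup>+x. ennreal (f x) \<partial>lborel)"
      by (intro nn_integral_mono) (auto simp: indicator_def intro!: ennreal_leI)
    then have "ennreal b * emeasure lborel K < \<infinity>"
      using integrable K_borel by (simp add: nn_integral_cmult_indicator)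
    then show ?thesis using b by (auto simp: ennreal_mult_less_top)
  qed
  have "\<exists>\<rho>>0. ball 0 \<rho> \<subseteq> K"
  proof -
    have "open (interior dom \<inter> \<phi> -` {..<\<phi> 0 + 1})"
      by (rule continuous_open_preimage[OF continuous_interior open_interior open_lessThan])
    moreover have "0 \<in> interior dom \<inter> \<phi> -` {..<\<phi> 0 + 1}" using origin by simp
    ultimately obtain \<rho> where "\<rho> > 0" "ball 0 \<rho> \<subseteq> interior dom \<inter> \<phi> -` {..<\<phi> 0 + 1}"
      by (rule openE)
    then show ?thesis using interior_subset[of dom] by (auto simp: K_def)
  qed
  then have "bounded K"
    using bounded_convex_finite_measure[OF \<open>convex K\<close> K_borel \<open>emeasure lborel K < \<infinity>\<close>] by blast
  then obtain R where R: "\<And>x. x \<in> K \<Longrightarrow> norm x \<le> R" by (auto simp: bounded_iff)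
  show ?thesis
  proof (rule that[of "\<bar>R\<bar> + 1"])
    fix x assume "\<bar>R\<bar> + 1 \<le> norm x" "x \<in> dom"
    with R[of x] show "\<phi> 0 + 1 \<le> \<phi> x" by (fastforce simp: K_def not_less)
  qed simp
qed

text \<open>Outside radius \<open>R\<close> convexity along rays turns the gain of \<open>1\<close>
  at radius \<open>R\<close> into \<open>\<phi> x \<ge> \<phi> 0 + norm x / R\<close>. Inside,
  \<open>f\<close> is bounded by comparing \<open>x\<close> with a point on the opposite side of the
  origin.\<close>

lemma exp_decay:
  obtains A c where "A > 0" "c > 0" "\<And>x. f x \<le> A * exp (- c * norm x)"
proof -
  obtain r M where r: "r > 0" "cball 0 r \<subseteq> dom" "\<And>y. y \<in> cball 0 r \<Longrightarrow> \<phi> y \<le> M"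
    by (rule locally_bounded) blast
  obtain R where R: "R > 0" "\<And>x. R \<le> norm x \<Longrightarrow> x \<in> dom \<Longrightarrow> \<phi> 0 + 1 \<le> \<phi> x"
    by (rule level_set_bounded) blast
  \<comment> \<open>The factor \<open>u\<close> brings \<open>- u x\<close> into the ball of radius
    \<open>r\<close> whenever \<open>norm x < R\<close>. The bound \<open>L\<close> on
    \<open>- \<phi> x\<close> results from solving
    \<open>(1 + u) \<phi> 0 \<le> u \<phi> x + M\<close>.\<close>
  define u where "u = r / R"
  have u: "u > 0" using r R by (simp add: u_def)
  define L where "L = (M - (1 + u) * \<phi> 0) / u"
  have far: "f x \<le> f 0 * exp (- (norm x / R))" if x: "R \<le> norm x" for x
  proof (cases "x \<in> dom")
    case True
    define s where "s = norm x / R"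
    have s: "s \<ge> 1" using x R by (simp add: s_def)
    \<comment> \<open>The radial projection of \<open>x\<close> to the sphere of radius
      \<open>R\<close>.\<close>
    define y where "y = (1 / s) *\<^sub>R x"
    have sy: "s *\<^sub>R y = x" using s by (simp add: y_def)
    have "x \<noteq> 0" using R(1) x by auto
    then have ny: "norm y = R" using R(1) by (simp add: y_def s_def)
    have y: "y \<in> dom" "s * \<phi> y - (s - 1) * \<phi> 0 \<le> \<phi> x"
      using neg_log_ray[OF s, of y] True unfolding sy by auto
    have "s * (\<phi> 0 + 1) \<le> s * \<phi> y"
      using s R(2)[of y] y ny by (intro mult_left_mono) auto
    then have "\<phi> 0 + s \<le> \<phi> x" using y(2) by (simp add: algebra_simps)
    then have "exp (- \<phi> x) \<le> exp (- \<phi> 0 - s)" by simp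
    also have "exp (- \<phi> 0 - s) = f 0 * exp (- s)"
      using f_0_pos by (simp add: exp_diff exp_minus field_simps)
    finally show ?thesis using True by (simp add: s_def)
  next
    case False
    then have "f x = 0" by (rule eq_0_outside_dom)
    then show ?thesis using f_0_pos by simp
  qed
  have near: "f x \<le> exp L" if x: "norm x < R" for x
  proof (cases "x \<in> dom")
    case True
    define y where "y = - u *\<^sub>R x"
    have "norm y = u * norm x" using u by (simp add: y_def)
    also have "\<dots> \<le> r" using x r R by (simp add: u_def field_simps)
    finally have y: "y \<in> dom" "\<phi> y \<le> M" using r(2) r(3)[of y] by auto
    \<comment> \<open>With this weight the origin is the convex combination of \<open>x\<close> and
      \<open>- u x\<close>.\<close>
    define t where "t = 1 / (1 + u)"
    have t: "0 \<le> t" "t \<le> 1" "1 - t = u * t" using u by (auto simp: t_def field_simps)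
    have "(1 - t) *\<^sub>R x + t *\<^sub>R y = 0"
      unfolding t(3) by (simp add: y_def)
    moreover have "\<phi> ((1 - t) *\<^sub>R x + t *\<^sub>R y) \<le> (1 - t) * \<phi> x + t * \<phi> y"
      using t True y by (intro convex_onD[OF conv]) auto
    ultimately have "\<phi> 0 \<le> u * t * \<phi> x + t * \<phi> y" using t(3) by simp
    also have "\<dots> \<le> t * (u * \<phi> x + M)"
      using mult_left_mono[OF y(2) t(1)] by (simp add: distrib_left right_diff_distrib mult.assoc mult.left_commute)
    finally have "(1 + u) * \<phi> 0 \<le> u * \<phi> x + M"
      using u by (simp add: t_def field_simps)
    then have L: "- \<phi> x \<le> L" using u by (simp add: L_def field_simps)
    have "f x = exp (- \<phi> x)" using True by simp
    also have "\<dots> \<le> exp L" using L by (simp only: exp_le_cancel_iff)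
    finally show ?thesis .
  next
    case False
    then have "f x = 0" by (rule eq_0_outside_dom)
    then show ?thesis by simp
  qed
  show ?thesis
  \<comment> \<open>The factor \<open>exp 1\<close> compensates for
    \<open>exp (- norm x / R)\<close>, which is at least \<open>exp (- 1)\<close> inside radius
    \<open>R\<close>.\<close>
  proof (rule that[of "f 0 + exp L * exp 1" "1 / R"])
    fix x :: 'a
    show "f x \<le> (f 0 + exp L * exp 1) * exp (- (1 / R) * norm x)"
    proof (cases "norm x < R")
      case True
      have "f x \<le> exp L" by (rule near[OF True])
      also have "exp L \<le> exp L * exp 1 * exp (- (norm x / R))"
        using True R by (simp add: exp_add[symmetric] mult.assoc)
      also have "\<dots> \<le> (f 0 + exp L * exp 1) * exp (- (norm x / R))"
        using f_0_pos by (intro mult_right_mono) auto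
      finally show ?thesis by simp
    next
      case False
      then have "f x \<le> f 0 * exp (- (norm x / R))" by (intro far) auto
      also have "\<dots> \<le> (f 0 + exp L * exp 1) * exp (- (norm x / R))"
        by (intro mult_right_mono) auto
      finally show ?thesis by simp
    qed
  qed (use f_0_pos R in \<open>auto intro: add_pos_pos\<close>)
qed

section \<open>Weighted integrals and dilations\<close>

lemma weighted_integral_finite:
  assumes "q > 0"
  shows "(\<integral>\<^sup>+x. ennreal (norm x powr (q - real DIM('a)) * f x) \<partial>lborel) < \<infinity>"
proof -
  obtain A c where "A > 0" "c > 0" "\<And>x. f x \<le> A * exp (- c * norm x)" by (rule exp_decay) blast
  then show ?thesis using assms nonneg by (intro nn_integral_radial_exp_decay[of q c A]) auto
qed

lemma scaled_weighted_integral: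
  assumes s: "s > 0"
  shows "(\<integral>\<^sup>+x. ennreal (norm x powr (q - real DIM('a)) * f (s *\<^sub>R x)) \<partial>lborel) =
    ennreal (s powr - q) * (\<integral>\<^sup>+x. ennreal (norm x powr (q - real DIM('a)) * f x) \<partial>lborel)"
    (is "?J = _ * ?I")
proof -
  let ?n = "real DIM('a)"
  have "?I = ennreal (\<bar>s\<bar> ^ DIM('a)) * (\<integral>\<^sup>+x. ennreal (norm (s *\<^sub>R x) powr (q - ?n) * f (s *\<^sub>R x)) \<partial>lborel)"
    using s by (intro nn_integral_lborel_scaleR) auto
  also have "(\<integral>\<^sup>+x. ennreal (norm (s *\<^sub>R x) powr (q - ?n) * f (s *\<^sub>R x)) \<partial>lborel) =
      (\<integral>\<^sup>+x. ennreal (s powr (q - ?n)) * ennreal (norm x powr (q - ?n) * f (s *\<^sub>R x)) \<partial>lborel)"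
    using s nonneg by (simp add: powr_mult ennreal_mult[symmetric] mult.assoc)
  also have "\<dots> = ennreal (s powr (q - ?n)) * ?J"
    by (intro nn_integral_cmult) measurable
  also have "ennreal (\<bar>s\<bar> ^ DIM('a)) * (ennreal (s powr (q - ?n)) * ?J) = ennreal (s powr q) * ?J"
  proof -
    have "\<bar>s\<bar> ^ DIM('a) * s powr (q - ?n) = s powr q"
      using s by (simp add: powr_realpow[symmetric] powr_add[symmetric])
    then show ?thesis by (simp add: mult.assoc[symmetric] ennreal_mult[symmetric])
  qed
  finally have "ennreal (s powr - q) * ?I = ennreal (s powr - q * s powr q) * ?J"
    by (simp add: mult.assoc[symmetric] ennreal_mult[symmetric])
  also have "s powr - q * s powr q = 1"
    using s by (simp add: powr_add[symmetric])
  finally show ?thesis by simp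
qed

text \<open>The ray inequality and \<open>\<phi> x \<ge> - ln A\<close> give
  \<open>\<phi> ((1 + t) x) \<ge> \<phi> x - t a\<close>, and the factor \<open>exp (t * a)\<close>
  is then linearised for \<open>t \<le> 1\<close>. The outcome bounds
  \<open>(f x - f ((1 + t) x)) / t\<close> below by a multiple of \<open>- f x\<close> that does not
  depend on \<open>t\<close>, as Fatou's lemma requires.\<close>

lemma scaled_le:
  assumes A: "\<And>x. f x \<le> A" and t: "0 < t" "t \<le> 1"
  defines "a \<equiv> \<phi> 0 + ln A"
  shows "f ((1 + t) *\<^sub>R x) \<le> f x * (1 + t * (a * exp a))"
proof -
  have A0: "A > 0" using A[of 0] f_0_pos by linarith
  have a: "a \<ge> 0" using A[of 0] A0 f_0_pos by (simp add: a_def)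
  have "f ((1 + t) *\<^sub>R x) \<le> f x * exp (t * a)"
  proof (cases "(1 + t) *\<^sub>R x \<in> dom")
    case True
    have x: "x \<in> dom" "(1 + t) * \<phi> x - (1 + t - 1) * \<phi> 0 \<le> \<phi> ((1 + t) *\<^sub>R x)"
      using neg_log_ray[of "1 + t" x] True t by auto
    have "- ln A \<le> \<phi> x" using A[of x] x(1) A0 by simp
    then have "t * (- ln A) \<le> t * \<phi> x" using t by (intro mult_left_mono) auto
    then have "\<phi> x - t * a \<le> \<phi> ((1 + t) *\<^sub>R x)"
      using x(2) by (simp add: a_def algebra_simps)
    then have "exp (- \<phi> ((1 + t) *\<^sub>R x)) \<le> exp (- \<phi> x + t * a)" by simp
    then show ?thesis using True x(1) by (simp add: exp_add)
  next
    case False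
    then have "f ((1 + t) *\<^sub>R x) = 0" by (rule eq_0_outside_dom)
    then show ?thesis using nonneg[of x] by simp
  qed
  also have "\<dots> \<le> f x * (1 + t * (a * exp a))"
  proof (intro mult_left_mono nonneg)
    have "1 - t * a \<le> exp (- (t * a))" using exp_ge_add_one_self[of "- (t * a)"] by simp
    then have "(1 - t * a) * exp (t * a) \<le> exp (- (t * a)) * exp (t * a)"
      by (intro mult_right_mono) auto
    then have "exp (t * a) \<le> 1 + t * a * exp (t * a)"
      by (simp add: exp_add[symmetric] algebra_simps)
    also have "t * a * exp (t * a) \<le> t * a * exp a"
      using t a by (intro mult_left_mono) (auto intro: mult_left_le_one_le)
    finally show "exp (t * a) \<le> 1 + t * (a * exp a)" by (simp add: mult.assoc)
  qed
  finally show ?thesis .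
qed

lemma difference_quotient_integral_le:
  assumes q: "q > 0" and t: "0 < t"
    and pos: "\<And>x. 0 \<le> (f x - f ((1 + t) *\<^sub>R x)) / t + C * f x" and C: "C \<ge> 0"
  shows "(\<integral>\<^sup>+x. ennreal (norm x powr (q - real DIM('a)) * ((f x - f ((1 + t) *\<^sub>R x)) / t + C * f x)) \<partial>lborel)
    \<le> ennreal (q + C) * (\<integral>\<^sup>+x. ennreal (norm x powr (q - real DIM('a)) * f x) \<partial>lborel)"
    (is "?J \<le> _ * ?I")
proof -
  let ?w = "\<lambda>x::'a. norm x powr (q - real DIM('a))"
  obtain i where i: "?I = ennreal i" "i \<ge> 0"
    using weighted_integral_finite[OF q] by (cases ?I) auto
  \<comment> \<open>The dilated term is added on the left, since subtraction in
    \<open>ennreal\<close> is truncated.\<close>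
  have "?J + ennreal (1 / t) * (\<integral>\<^sup>+x. ennreal (?w x * f ((1 + t) *\<^sub>R x)) \<partial>lborel) =
      (\<integral>\<^sup>+x. ennreal (?w x * ((f x - f ((1 + t) *\<^sub>R x)) / t + C * f x)) +
        ennreal (1 / t) * ennreal (?w x * f ((1 + t) *\<^sub>R x)) \<partial>lborel)"
    by (subst nn_integral_add, measurable) (simp add: nn_integral_cmult)
  also have "\<dots> = (\<integral>\<^sup>+x. ennreal (1 / t + C) * ennreal (?w x * f x) \<partial>lborel)"
  proof (intro nn_integral_cong)
    fix x
    have "ennreal (?w x * ((f x - f ((1 + t) *\<^sub>R x)) / t + C * f x)) +
        ennreal (1 / t) * ennreal (?w x * f ((1 + t) *\<^sub>R x)) =
      ennreal (?w x * ((f x - f ((1 + t) *\<^sub>R x)) / t + C * f x) + 1 / t * (?w x * f ((1 + t) *\<^sub>R x)))"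
      using t pos[of x] nonneg by (simp add: ennreal_mult[symmetric])
    also have "?w x * ((f x - f ((1 + t) *\<^sub>R x)) / t + C * f x) + 1 / t * (?w x * f ((1 + t) *\<^sub>R x)) =
        (1 / t + C) * (?w x * f x)"
      using t by (simp add: field_simps)
    finally show "ennreal (?w x * ((f x - f ((1 + t) *\<^sub>R x)) / t + C * f x)) +
        ennreal (1 / t) * ennreal (?w x * f ((1 + t) *\<^sub>R x)) = ennreal (1 / t + C) * ennreal (?w x * f x)"
      using t C nonneg by (simp add: ennreal_mult)
  qed
  also have "\<dots> = ennreal (1 / t + C) * ?I"
    by (intro nn_integral_cmult) measurable
  also have "(\<integral>\<^sup>+x. ennreal (?w x * f ((1 + t) *\<^sub>R x)) \<partial>lborel) = ennreal ((1 + t) powr - q) * ?I"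
    using t by (intro scaled_weighted_integral) auto
  finally have eq: "?J + ennreal (1 / t * (1 + t) powr - q * i) = ennreal ((1 / t + C) * i)"
    using t C i by (simp add: ennreal_mult[symmetric] mult.assoc del: ennreal_plus)
  \<comment> \<open>Finiteness allows the identity to be read in the reals, where the dilated term
    can be subtracted.\<close>
  then have "?J \<noteq> \<infinity>" by (metis ennreal_neq_top ennreal_add_eq_top infinity_ennreal_def)
  then obtain j where j: "?J = ennreal j" "j \<ge> 0" by (cases ?J) auto
  have "j + 1 / t * (1 + t) powr - q * i = (1 / t + C) * i"
    using eq j i t C by (simp add: ennreal_plus[symmetric] del: ennreal_plus)
  \<comment> \<open>A Bernoulli inequality, from \<open>ln (1 + t) \<le> t\<close> and
    \<open>1 + u \<le> exp u\<close>.\<close>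
  moreover have "1 - q * t \<le> (1 + t) powr - q"
  proof -
    have "q * ln (1 + t) \<le> q * t" using q t ln_add_one_self_le_self[of t] by simp
    moreover have "1 + (- q * ln (1 + t)) \<le> exp (- q * ln (1 + t))"
      by (rule exp_ge_add_one_self)
    ultimately show ?thesis using t by (simp add: powr_def)
  qed
  then have "1 / t * (1 - q * t) * i \<le> 1 / t * (1 + t) powr - q * i"
    using t i by (intro mult_right_mono mult_left_mono) auto
  moreover have "1 / t * (1 - q * t) * i = 1 / t * i - q * i"
    using t by (simp add: field_simps)
  ultimately have "j \<le> (q + C) * i" unfolding distrib_right by linarith
  then show ?thesis
    using i j q C by (simp add: ennreal_mult[symmetric] ennreal_leI del: ennreal_plus)
qed

section \<open>Finiteness of the gradient integral\<close>

lemma gradient_integral_finite: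
  assumes q: "q > 0" and [measurable]: "G \<in> borel_measurable borel"
    and D: "\<And>x. x \<in> D \<Longrightarrow> x \<in> interior dom" "\<And>x. x \<in> D \<Longrightarrow> GDERIV \<phi> x :> G x"
    and G0: "\<And>x. x \<notin> D \<Longrightarrow> G x = 0"
  shows "(\<integral>\<^sup>+x. ennreal (norm (G x)) * ennreal (norm x powr (q - real DIM('a)) * f x) \<partial>lborel) < \<infinity>"
proof -
  let ?w = "\<lambda>x::'a. norm x powr (q - real DIM('a))"
  obtain r M where r: "r > 0" "cball 0 r \<subseteq> dom" "\<And>y. y \<in> cball 0 r \<Longrightarrow> \<phi> y \<le> M"
    by (rule locally_bounded) blast
  obtain A c where Ac: "A > 0" "c > 0" "\<And>x. f x \<le> A * exp (- c * norm x)"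
    by (rule exp_decay) blast
  have A: "f x \<le> A" for x
  proof -
    have "A * exp (- c * norm x) \<le> A * 1" using Ac by (intro mult_left_mono) auto
    with Ac(3)[of x] show ?thesis by linarith
  qed
  define a where "a = \<phi> 0 + ln A"
  have "f 0 \<le> A" by (rule A)
  then have a: "a \<ge> 0" using Ac(1) f_0_pos by (simp add: a_def)
  \<comment> \<open>The term \<open>a * exp a\<close> makes the functions \<open>g k\<close>
    nonnegative. The term \<open>M + ln A\<close> dominates \<open>M - \<phi> x\<close> in the
    subgradient inequality, as \<open>f x \<le> A\<close>.\<close>
  define C where "C = max (M + ln A) (a * exp a)"
  have C: "C \<ge> a * exp a" "C \<ge> M + ln A" "C \<ge> 0"
    using a by (auto simp: C_def le_max_iff_disj)
  define t where "t k = 1 / real (Suc k)" for k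
  have t: "0 < t k" "t k \<le> 1" for k by (auto simp: t_def)
  define g where "g k x = (f x - f ((1 + t k) *\<^sub>R x)) / t k + C * f x" for k x
  have g_pos: "0 \<le> g k x" for k x
  proof -
    have "f ((1 + t k) *\<^sub>R x) \<le> f x * (1 + t k * (a * exp a))"
      unfolding a_def using t by (intro scaled_le A)
    also have "\<dots> \<le> f x * (1 + t k * C)"
      using C(1) t[of k] by (intro mult_left_mono nonneg) auto
    finally show ?thesis using t[of k] by (simp add: g_def field_simps)
  qed
  have g_meas [measurable]: "(\<lambda>x. ennreal (?w x * g k x)) \<in> borel_measurable lborel" for k
    unfolding g_def by measurable
  let ?I = "\<integral>\<^sup>+x. ennreal (?w x * f x) \<partial>lborel"
  have g_int: "(\<integral>\<^sup>+x. ennreal (?w x * g k x) \<partial>lborel) \<le> ennreal (q + C) * ?I" for k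
    unfolding g_def using t[of k] C(3) g_pos[of k] by (intro difference_quotient_integral_le[OF q]) (auto simp: g_def)
  have lower: "ennreal r * (ennreal (norm (G x)) * ennreal (?w x * f x)) \<le> liminf (\<lambda>k. ennreal (?w x * g k x))" for x
  proof (cases "x \<in> D")
    case True
    have x: "x \<in> dom" using D(1)[OF True] interior_subset[of dom] by blast
    have "((\<lambda>t. (f (x + t *\<^sub>R x) - f x) / t) \<longlongrightarrow> x \<bullet> (- f x *\<^sub>R G x)) (at 0)"
      by (intro GDERIV_directional GDERIV_of_neg_log D True)
    moreover have "filterlim t (at 0) sequentially"
      using LIMSEQ_inverse_real_of_nat unfolding t_def by (simp add: filterlim_at inverse_eq_divide)
    ultimately have "(\<lambda>k. (f (x + t k *\<^sub>R x) - f x) / t k) \<longlonglongrightarrow> x \<bullet> (- f x *\<^sub>R G x)"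
      by (rule filterlim_compose)
    then have "(\<lambda>k. ?w x * (- ((f (x + t k *\<^sub>R x) - f x) / t k) + C * f x)) \<longlonglongrightarrow> ?w x * (- (x \<bullet> (- f x *\<^sub>R G x)) + C * f x)"
      by (intro tendsto_intros)
    moreover have "- ((f (x + t k *\<^sub>R x) - f x) / t k) + C * f x = g k x" for k
      by (simp add: g_def scaleR_add_left minus_divide_left)
    ultimately have "(\<lambda>k. ?w x * g k x) \<longlonglongrightarrow> ?w x * (f x * (x \<bullet> G x) + C * f x)"
      by simp
    then have "(\<lambda>k. ennreal (?w x * g k x)) \<longlonglongrightarrow> ennreal (?w x * (f x * (x \<bullet> G x) + C * f x))"
      by (rule tendsto_ennrealI)
    then have lim: "liminf (\<lambda>k. ennreal (?w x * g k x)) = ennreal (?w x * (f x * (x \<bullet> G x) + C * f x))"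
      by (intro lim_imp_Liminf) simp
    have "r * norm (G x) \<le> x \<bullet> G x + C"
    proof -
      \<comment> \<open>The point of the ball with the largest inner product with
        \<open>G x\<close>. If \<open>G x = 0\<close>, then \<open>sgn\<close> yields
        \<open>0\<close> and no separate choice is required.\<close>
      define y where "y = r *\<^sub>R sgn (G x)"
      have y: "y \<in> cball 0 r" using r(1) by (simp add: y_def norm_sgn)
      have yG: "y \<bullet> G x = r * norm (G x)"
        by (cases "G x = 0") (simp_all add: y_def sgn_div_norm power2_norm_eq_inner[symmetric] power2_eq_square)
      have "\<phi> x + (y - x) \<bullet> G x \<le> \<phi> y"
        using y r(2) by (intro convex_on_gradient_le[OF conv x D(2)[OF True]]) auto
      moreover have "\<phi> y \<le> M" using r(3) y .
      moreover have "- ln A \<le> \<phi> x" using A[of x] x Ac(1) by simp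
      ultimately show ?thesis using C(2) yG by (simp add: inner_diff_left)
    qed
    then have "(?w x * f x) * (r * norm (G x)) \<le> (?w x * f x) * (x \<bullet> G x + C)"
      using nonneg by (intro mult_left_mono) auto
    then have "r * (norm (G x) * (?w x * f x)) \<le> ?w x * (f x * (x \<bullet> G x) + C * f x)"
      by (simp add: algebra_simps)
    then show ?thesis
      unfolding lim using r(1) nonneg by (simp add: ennreal_mult[symmetric] ennreal_leI)
  qed (simp add: G0)
  have "ennreal r * (\<integral>\<^sup>+x. ennreal (norm (G x)) * ennreal (?w x * f x) \<partial>lborel)
      = (\<integral>\<^sup>+x. ennreal r * (ennreal (norm (G x)) * ennreal (?w x * f x)) \<partial>lborel)"
    by (intro nn_integral_cmult[symmetric]) measurable
  also have "\<dots> \<le> (\<integral>\<^sup>+x. liminf (\<lambda>k. ennreal (?w x * g k x)) \<partial>lborel)"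
    by (intro nn_integral_mono lower)
  also have "\<dots> \<le> liminf (\<lambda>k. \<integral>\<^sup>+x. ennreal (?w x * g k x) \<partial>lborel)"
    by (intro nn_integral_liminf) measurable
  also have "\<dots> \<le> ennreal (q + C) * ?I"
    by (intro Liminf_le) (auto intro: always_eventually g_int)
  also have "\<dots> < \<infinity>"
    using weighted_integral_finite[OF q] by (simp add: ennreal_mult_less_top)
  finally show ?thesis using r(1) by (auto simp: ennreal_mult_less_top)
qed

end

section \<open>The dual curvature measure\<close>

text \<open>Lower semicontinuity of \<open>neg_log f\<close> makes the sets
  \<open>{x. f x < a}\<close> open, hence \<open>f\<close> Borel. Between points with
  \<open>f > 0\<close> the extended convexity inequality has a finite right side, so
  \<open>f\<close> stays positive and the inequality is one of reals.\<close>

lemma LC_log_concave: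
  assumes f: "f \<in> LC"
  shows "log_concave f"
proof
  have nonneg: "\<And>x. 0 \<le> f x" and conv: "convex_fun (neg_log f)" and lsc: "lower_semicontinuous (neg_log f)"
    using f by (auto simp: LC_iff_neg_log)
  show "0 \<le> f x" for x by (rule nonneg)
  show "f \<in> borel_measurable borel"
  proof (rule borel_measurableI_less)
    fix a
    have "open {x. f x < a}"
    proof (cases "a > 0")
      case True
      have iff: "f x < a \<longleftrightarrow> ereal (- ln a) < neg_log f x" for x
        using True nonneg[of x] by (auto simp: neg_log_def less_le)
      show ?thesis
        unfolding open_subopen[of "{x. f x < a}"]
      proof (intro ballI)
        fix x assume "x \<in> {x. f x < a}"
        then have "\<forall>\<^sub>F y in nhds x. ereal (- ln a) < neg_log f y"
          using lsc unfolding lower_semicontinuous_def iff by blast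
        then show "\<exists>T. open T \<and> x \<in> T \<and> T \<subseteq> {x. f x < a}"
          unfolding eventually_nhds iff by blast
      qed
    next
      case False
      then have "{x. f x < a} = {}" using nonneg by (auto simp: not_less intro: order_trans)
      then show ?thesis by simp
    qed
    then show "{x \<in> space borel. f x < a} \<in> sets borel" by simp
  qed
  have key: "0 < f ((1 - t) *\<^sub>R x + t *\<^sub>R y) \<and>
      - ln (f ((1 - t) *\<^sub>R x + t *\<^sub>R y)) \<le> (1 - t) * (- ln (f x)) + t * (- ln (f y))"
    if "0 < f x" "0 < f y" "0 \<le> t" "t \<le> 1" for x y and t :: real
  proof -
    let ?z = "(1 - t) *\<^sub>R x + t *\<^sub>R y"
    have "neg_log f ?z \<le> ereal (1 - t) * neg_log f x + ereal t * neg_log f y"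
      using conv that by (auto simp: convex_fun_def)
    also have "\<dots> = ereal ((1 - t) * (- ln (f x)) + t * (- ln (f y)))"
      using that by (simp add: neg_log_def)
    finally have "neg_log f ?z \<le> \<dots>" .
    then show ?thesis
      using nonneg[of ?z] by (auto simp: neg_log_def less_le split: if_splits)
  qed
  show "convex_on {x. 0 < f x} (\<lambda>x. - ln (f x))"
  proof (rule convex_onI)
    show "convex {x. 0 < f x}"
      unfolding convex_alt using key by blast
  qed (use key in auto)
qed

lemma has_ext_gradient_neg_log:
  assumes "\<And>x. 0 \<le> f x"
  shows "has_ext_gradient (neg_log f) x v \<longleftrightarrow> x \<in> interior {x. 0 < f x} \<and> GDERIV (\<lambda>x. - ln (f x)) x :> v"
proof -
  have "{y. \<bar>neg_log f y\<bar> \<noteq> \<infinity>} = {y. 0 < f y}"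
    using assms by (auto simp: neg_log_def less_le)
  \<comment> \<open>Where \<open>f y = 0\<close> both sides are \<open>0\<close>, by the conventions
    for \<open>real_of_ereal \<infinity>\<close> and \<open>ln 0\<close>.\<close>
  moreover have "(\<lambda>y. real_of_ereal (neg_log f y)) = (\<lambda>y. - ln (f y))"
    by (auto simp: neg_log_def)
  ultimately show ?thesis by (simp add: has_ext_gradient_def)
qed

lemma gradient_eqI: "GDERIV f x :> v \<Longrightarrow> gradient f x = v"
  unfolding gradient_def by (auto intro: the_equality GDERIV_unique)

section \<open>The gradient map of the exponent and its image measure\<close>

context log_concave
begin

definition diff_points :: "'a set" where
  "diff_points = {x \<in> interior dom. \<phi> differentiable (at x)}"

text \<open>Extension by \<open>0\<close> gives a Borel map on the whole space and agrees with the
  convention of \<open>gradient\<close> at points without a derivative.\<close>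

definition grad_neg_log :: "'a \<Rightarrow> 'a" where
  "grad_neg_log x = (if x \<in> diff_points then THE v. GDERIV \<phi> x :> v else 0)"

lemma diff_points_borel [measurable]: "diff_points \<in> sets borel"
  unfolding diff_points_def by (intro borel_differentiable_points continuous_interior open_interior)

lemma GDERIV_grad_neg_log:
  assumes "x \<in> diff_points"
  shows "GDERIV \<phi> x :> grad_neg_log x"
proof -
  from assms obtain v where v: "GDERIV \<phi> x :> v"
    by (auto simp: diff_points_def differentiable_iff_GDERIV)
  have "(THE v. GDERIV \<phi> x :> v) = v"
    using v by (intro the_equality GDERIV_unique[of \<phi> x])
  with v assms show ?thesis by (simp add: grad_neg_log_def)
qed

lemma grad_neg_log_eq_0 [simp]: "x \<notin> diff_points \<Longrightarrow> grad_neg_log x = 0"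
  by (simp add: grad_neg_log_def)

lemma grad_neg_log_borel [measurable]: "grad_neg_log \<in> borel_measurable borel"
  by (rule borel_measurable_gradient_on[of \<phi> diff_points])
     (auto intro: GDERIV_grad_neg_log)

text \<open>The frontier of a convex set is Lebesgue negligible; the statement passes from the
  completion \<open>lebesgue\<close> to \<open>lborel\<close>.\<close>

lemma AE_not_frontier: "AE x in lborel. x \<notin> frontier dom"
proof -
  have "frontier dom \<in> null_sets lebesgue"
    using negligible_convex_frontier[OF convex_dom] by (simp add: negligible_iff_null_sets)
  then have "AE x in lebesgue. x \<notin> frontier dom" by (rule AE_not_in)
  then show ?thesis by (simp add: AE_completion_iff)
qed

end

text \<open>By uniqueness of gradients, the points with a gradient in \<open>B\<close> are those of
  \<open>diff_points\<close> that \<open>grad_neg_log\<close> sends into \<open>B\<close>. In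
  particular the set function given to \<open>measure_of\<close> is a true measure, so the
  definition does not fall back to the zero measure.\<close>

lemma dual_curvature_measure_eq_distr:
  fixes f :: "real^'n \<Rightarrow> real"
  assumes "log_concave f"
  shows "dual_curvature_measure q f =
    distr (density lborel (\<lambda>x. indicator (log_concave.diff_points f) x * ennreal (norm x powr (q - real CARD('n)) * f x)))
      borel (log_concave.grad_neg_log f)"
proof -
  interpret log_concave f by fact
  show ?thesis
    unfolding dual_curvature_measure_def distr_def space_borel
  proof (rule measure_of_eq)
    fix B :: "(real^'n) set"
    assume "B \<in> sigma_sets UNIV (sets borel)"
    then have B [measurable]: "B \<in> sets borel"
      using sets.sigma_sets_eq[of "borel :: (real^'n) measure"] by simp
    have "has_ext_gradient (neg_log f) x v \<longleftrightarrow> x \<in> diff_points \<and> grad_neg_log x = v" for x v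
      using GDERIV_grad_neg_log[of x] GDERIV_unique[of \<phi> x "grad_neg_log x" v]
      unfolding has_ext_gradient_neg_log[OF nonneg]
      by (auto simp: diff_points_def differentiable_iff_GDERIV)
    then have "{x. \<exists>v\<in>B. has_ext_gradient (neg_log f) x v} = {x \<in> diff_points. grad_neg_log x \<in> B}"
      by simp
    then show "(\<integral>\<^sup>+x\<in>{x. \<exists>v\<in>B. has_ext_gradient (neg_log f) x v}. ennreal (norm x powr (q - real CARD('n)) * f x) \<partial>lborel) =
      emeasure (density lborel (\<lambda>x. indicator diff_points x * ennreal (norm x powr (q - real CARD('n)) * f x)))
        (grad_neg_log -` B \<inter> space (density lborel (\<lambda>x. indicator diff_points x * ennreal (norm x powr (q - real CARD('n)) * f x))))"
      using measurable_sets[OF grad_neg_log_borel B]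
      by (subst emeasure_density; (intro nn_integral_cong)?) (auto simp: indicator_def)
  qed simp
qed

lemma nn_integral_dual_curvature_measure:
  fixes f :: "real^'n \<Rightarrow> real"
  assumes "log_concave f"
  shows "(\<integral>\<^sup>+x. ennreal (norm x) \<partial>dual_curvature_measure q f) =
    (\<integral>\<^sup>+x. ennreal (norm (log_concave.grad_neg_log f x)) * ennreal (norm x powr (q - real CARD('n)) * f x) \<partial>lborel)"
proof -
  interpret log_concave f by fact
  show ?thesis
    unfolding dual_curvature_measure_eq_distr[OF assms]
    \<comment> \<open>The indicator of \<open>diff_points\<close> disappears because
      \<open>grad_neg_log\<close> vanishes off that set.\<close>
    by (subst nn_integral_distr, simp, simp, subst nn_integral_density)
       (auto simp: indicator_def mult.commute intro!: nn_integral_cong)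
qed

lemma nn_integral_norm_gradient:
  fixes f :: "real^'n \<Rightarrow> real"
  assumes "log_concave f"
  shows "(\<integral>\<^sup>+x. ennreal (norm (gradient f x) * norm x powr p) \<partial>lborel) =
    (\<integral>\<^sup>+x. ennreal (norm (log_concave.grad_neg_log f x)) * ennreal (norm x powr p * f x) \<partial>lborel)"
proof -
  interpret log_concave f by fact
  have grad: "gradient f x = - f x *\<^sub>R grad_neg_log x" if x: "x \<notin> frontier dom" for x
  proof -
    \<comment> \<open>The chain rule settles the first case. In the second \<open>f\<close> has no
      derivative, and both gradients are \<open>0\<close> by convention. In the third
      \<open>f\<close> vanishes near \<open>x\<close>.\<close>
    consider "x \<in> diff_points" | "x \<in> interior dom" "x \<notin> diff_points" | "x \<notin> closure dom"
      using x by (auto simp: frontier_def)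
    then show ?thesis
    proof cases
      case 1
      then show ?thesis
        by (intro gradient_eqI GDERIV_of_neg_log GDERIV_grad_neg_log) (auto simp: diff_points_def)
    next
      case 2
      then have "\<nexists>v. GDERIV f x :> v"
        using neg_log_differentiable by (auto simp: diff_points_def differentiable_iff_GDERIV)
      then show ?thesis using 2 by (simp add: gradient_def grad_neg_log_def)
    next
      case 3
      have zero: "f y = 0" if "y \<in> - closure dom" for y
      proof (rule eq_0_outside_dom, rule notI)
        assume "y \<in> dom"
        then have "y \<in> closure dom" by (rule subsetD[OF closure_subset])
        with that show False by simp
      qed
      have "GDERIV f x :> 0"
      proof (rule GDERIV_transform_open)
        show "GDERIV (\<lambda>_. 0) x :> 0" by (rule GDERIV_const)
        show "open (- closure dom)" by (rule open_Compl[OF closed_closure])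
        show "x \<in> - closure dom" using 3 by simp
        show "0 = f y" if "y \<in> - closure dom" for y
          using zero[OF that] by (rule sym)
      qed
      then have "gradient f x = 0" by (rule gradient_eqI)
      moreover have "f x = 0" using ComplI[of x "closure dom"] 3 zero by blast
      ultimately show ?thesis by simp
    qed
  qed
  show ?thesis
  proof (rule nn_integral_cong_AE)
    show "AE x in lborel. ennreal (norm (gradient f x) * norm x powr p) =
        ennreal (norm (grad_neg_log x)) * ennreal (norm x powr p * f x)"
      using AE_not_frontier
    proof eventually_elim
      case (elim x)
      then show ?case using nonneg[of x] by (simp add: grad ennreal_mult[symmetric] mult_ac)
    qed
  qed
qed

lemma dual_curvature_moment:
  fixes f :: "real^'n \<Rightarrow> real"
  assumes q: "q > 0" and f: "f \<in> LC" "(\<integral>\<^sup>+x. ennreal \<bar>f x\<bar> \<partial>lborel) < \<infinity>"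
    and origin: "0 \<in> interior {x. 0 < f x}"
  shows "(\<integral>\<^sup>+x. ennreal (norm x) \<partial>dual_curvature_measure q f) =
      (\<integral>\<^sup>+x. ennreal (norm (gradient f x) * norm x powr (q - real CARD('n))) \<partial>lborel) \<and>
    (\<integral>\<^sup>+x. ennreal (norm (gradient f x) * norm x powr (q - real CARD('n))) \<partial>lborel) < \<infinity>"
proof -
  have lc: "log_concave f" using f(1) by (rule LC_log_concave)
  interpret log_concave f by (rule lc)
  interpret log_concave_at_0 f
    using f(2) origin nonneg by unfold_locales simp_all
  have "(\<integral>\<^sup>+x. ennreal (norm (grad_neg_log x)) * ennreal (norm x powr (q - real DIM(real^'n)) * f x) \<partial>lborel) < \<infinity>"
    by (rule gradient_integral_finite[OF q grad_neg_log_borel, of diff_points])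
       (use GDERIV_grad_neg_log in \<open>auto simp: diff_points_def\<close>)
  then show ?thesis
    unfolding nn_integral_dual_curvature_measure[OF lc] nn_integral_norm_gradient[OF lc] by simp
qed

text \<open>A convex set without interior lies in its own frontier, which is null, and the integral
  of \<open>f\<close> would be \<open>0\<close>. So \<open>dom\<close> has an interior point
  \<open>x\<close>; by symmetry \<open>- x\<close> is one too, and \<open>0\<close> is their
  midpoint.\<close>

lemma even_origin_interior:
  fixes f :: "real^'n \<Rightarrow> real"
  assumes f: "log_concave f" "(\<integral>\<^sup>+x. ennreal (f x) \<partial>lborel) \<noteq> 0" and even: "\<And>x. f (- x) = f x"
  shows "0 \<in> interior {x. 0 < f x}"
proof -
  interpret log_concave f by (rule f)
  have "interior dom \<noteq> {}"
  proof
    assume "interior dom = {}"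
    then have "closure dom - frontier dom = {}" by (auto simp: frontier_def)
    then have sub: "dom \<subseteq> frontier dom" using closure_subset[of dom] by blast
    have "AE x in lborel. ennreal (f x) = 0"
      using AE_not_frontier
    proof eventually_elim
      case (elim x)
      then have "x \<notin> dom" using sub by blast
      then have "f x = 0" by (rule eq_0_outside_dom)
      then show ?case by simp
    qed
    then have "(\<integral>\<^sup>+x. ennreal (f x) \<partial>lborel) = (\<integral>\<^sup>+(x::real^'n). 0 \<partial>lborel)"
      by (rule nn_integral_cong_AE)
    with f(2) show False by simp
  qed
  then obtain x where x: "x \<in> interior dom" by blast
  have "uminus ` dom = dom"
  proof
    show "dom \<subseteq> uminus ` dom"
    proof
      fix y assume "y \<in> dom"
      then have "- y \<in> dom" by (simp add: even)
      then have "- (- y) \<in> uminus ` dom" by (rule imageI)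
      then show "y \<in> uminus ` dom" by simp
    qed
  qed (auto simp: even)
  then have "- x \<in> interior dom"
    using interior_negations[of dom] x by (metis imageI)
  then have "(1/2) *\<^sub>R x + (1/2) *\<^sub>R (- x) \<in> interior dom"
    using x by (intro convexD convex_interior convex_dom) auto
  then show ?thesis by simp
qed

theorem theorem5p12:
  fixes f :: "real^'n \<Rightarrow> real" and q :: real
  assumes "q > 0"
    and "f \<in> LC"
    and "(\<integral>\<^sup>+x. ennreal \<bar>f x\<bar> \<partial>lborel) \<noteq> 0"
    and "(\<integral>\<^sup>+x. ennreal \<bar>f x\<bar> \<partial>lborel) < \<infinity>"
  shows "(0 \<in> interior (supp f) \<longrightarrow>
            (\<integral>\<^sup>+x. ennreal (norm x) \<partial>dual_curvature_measure q f) =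
              (\<integral>\<^sup>+x. ennreal (norm (gradient f x) * norm x powr (q - real CARD('n))) \<partial>lborel) \<and>
            (\<integral>\<^sup>+x. ennreal (norm (gradient f x) * norm x powr (q - real CARD('n))) \<partial>lborel) < \<infinity>)
       \<and> ((\<forall>x. f (- x) = f x) \<longrightarrow>
            (\<integral>\<^sup>+x. ennreal (norm x) \<partial>dual_curvature_measure q f) =
              (\<integral>\<^sup>+x. ennreal (norm (gradient f x) * norm x powr (q - real CARD('n))) \<partial>lborel) \<and>
            (\<integral>\<^sup>+x. ennreal (norm (gradient f x) * norm x powr (q - real CARD('n))) \<partial>lborel) < \<infinity>)"
proof -
  have lc: "log_concave f" using assms(2) by (rule LC_log_concave)
  interpret log_concave f by (rule lc)
  note moment = dual_curvature_moment[OF assms(1,2,4)]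
  have "{x. f x \<noteq> 0} = {x. 0 < f x}" using nonneg by (auto simp: less_le)
  \<comment> \<open>A convex set and its closure have the same interior, so the closure in
    \<open>supp\<close> adds no interior points.\<close>
  then have "interior (supp f) = interior {x. 0 < f x}"
    by (simp add: supp_def convex_interior_closure[OF convex_dom])
  moreover have "0 \<in> interior {x. 0 < f x}" if "\<forall>x. f (- x) = f x"
    using even_origin_interior[OF lc] assms(3) that nonneg by simp
  ultimately show ?thesis using moment by simp
qed

end
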